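(* Let $L>0$, $I=[0,L]$, $\omega\in[0,1]\setminus\mathbb{Q}$, and let $T:\mathbb{T}^1\times I\to\mathbb{T}^1\times I$, $T(\theta,x)=(\theta+\omega,T_\theta(x))$, be continuous with all fibre maps $T_\theta:I\to I$ monotonically increasing. Write $\tau_n:=n\omega \bmod 1$. Assume: (i) $T_\theta(0)=0$ for all $\theta\in\mathbb{T}^1$, and there is some $\theta\in\mathbb{T}^1$ with $T_\theta\equiv 0$; (ii) there are $c,d>0$ with $\mathrm{dist}(\tau_n,0)\ge c\,n^{-d}$ for all integers $n\ge1$; (iii) there are $\alpha>2$ and $\gamma>0$ such that $DT_\theta(x)\le\alpha$ for all $(\theta,x)\in\mathbb{T}^1\times I$, and $DT_\theta(x)\le\alpha^{-\gamma}$ whenever $x\ge1$; (iv) there is $\beta>0$ with $\left|\frac{\partial}{\partial\theta}T_\theta(x)\right|\le\beta$ for all $(\theta,x)$; (v) there are $m\in\mathbb{N}$ with $m>4+\frac{4}{\gamma}$, a real number $a\ge(m+1)^d$, and a real number $0<b\le c$ with $\mathrm{dist}(\tau_n,0)\ge b$ for all $n=1,\dots,m-1$, such that $$T_\theta(x)\ \ge\ \min\{1,ax\}\cdot\min\left\{1,\tfrac{2}{b}\,\mathrm{dist}(\theta,0)\right\}\qquad\text{for all }(\theta,x)\in\mathbb{T}^1\times I .$$ Let $\varphi^+$ be the upper bounding graph of $T$ and $\Phi^+=\{(\theta,\varphi^+(\theta)):\theta\in\mathbb{T}^1\}$. Then the topological closure of $\Phi^+$ satisfies $$\overline{\Phi^+}=[0,\varphi^+]:=\{(\theta,x)\in\mathbb{T}^1\times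 I: 0\le x\le\varphi^+(\theta)\}.$$
   Context: $\mathbb{T}^1=\mathbb{R}/\mathbb{Z}$ is the circle and $\mathrm{dist}$ is its usual metric. $DT_\theta$ denotes the derivative of the fibre map $T_\theta$ with respect to $x$. The maps need not be differentiable everywhere: the conditions (iii) and (iv) on derivatives are understood in the sense that the stated inequalities hold for the liminf and limsup of the respective difference quotients. The global attractor of $T$ is $K:=\bigcap_{n=0}^\infty T^n(\mathbb{T}^1\times I)$, and the upper bounding graph is the function $\varphi^+:\mathbb{T}^1\to I$, $\varphi^+(\theta):=\max\{x\in I:(\theta,x)\in K\}$. It is an invariant graph, i.e. $T_\theta(\varphi^+(\theta))=\varphi^+(\theta+\omega)$ for all $\theta$. *)

theory Defs
  imports "HOL-Analysis.Analysis"
begin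

quotient_type circle = real / "\<lambda>x y :: real. x - y \<in> \<int>"
  morphisms rep_circle to_circle
proof (rule equivpI)
  show "reflp (\<lambda>x y :: real. x - y \<in> \<int>)"
    by (simp add: reflp_def)
  show "symp (\<lambda>x y :: real. x - y \<in> \<int>)"
    by (metis (mono_tags, lifting) Ints_minus minus_diff_eq sympI)
  show "transp (\<lambda>x y :: real. x - y \<in> \<int>)"
  proof (rule transpI)
    fix x y z :: real
    assume "x - y \<in> \<int>" "y - z \<in> \<int>"
    then have "(x - y) + (y - z) \<in> \<int>" by (rule Ints_add)
    then show "x - z \<in> \<int>" by simp
  qed
qed

instantiation circle :: ab_group_add
begin

lift_definition zero_circle :: circle is 0 .

lift_definition plus_circle :: "circle \<Rightarrow> circle \<Rightarrow> circle" is "(+)"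
  by (metis Ints_add add_diff_add)

lift_definition uminus_circle :: "circle \<Rightarrow> circle" is uminus
  by (metis Ints_minus minus_diff_minus)

lift_definition minus_circle :: "circle \<Rightarrow> circle \<Rightarrow> circle" is "(-)"
proof -
  fix x y u v :: real
  assume "x - y \<in> \<int>" "u - v \<in> \<int>"
  then have "(x - y) - (u - v) \<in> \<int>" by (rule Ints_diff)
  then show "(x - u) - (y - v) \<in> \<int>" by (simp add: algebra_simps)
qed

instance
  by standard (transfer, simp)+

end

lemma infdist_Ints_shift:
  fixes x y :: real
  assumes "x - y \<in> \<int>"
  shows "infdist x \<int> = infdist y \<int>"
proof -
  have le: "infdist u \<int> \<le> infdist v \<int>" if uv: "u - v \<in> \<int>" for u v :: real
  proof -
    obtain k :: real where k: "k \<in> \<int>" "infdist v \<int> = dist v k"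
      using infdist_attains_inf[of "\<int> :: real set" v] closed_Ints by (metis Ints_0 empty_iff)
    have "infdist u \<int> \<le> dist u (k + (u - v))"
      by (rule infdist_le) (intro Ints_add k uv)
    then show ?thesis by (simp add: k dist_real_def)
  qed
  have "y - x \<in> \<int>" using assms by (metis Ints_minus minus_diff_eq)
  then show ?thesis using le assms by (intro antisym) auto
qed

instantiation circle :: metric_space
begin

(* The quotient metric: the distance of x - y to the nearest integer. *)
lift_definition dist_circle :: "circle \<Rightarrow> circle \<Rightarrow> real" is "\<lambda>x y. infdist (x - y) \<int>"
proof (rule infdist_Ints_shift)
  fix x y u v :: real
  assume "x - y \<in> \<int>" "u - v \<in> \<int>"
  then have "(x - y) - (u - v) \<in> \<int>" by (rule Ints_diff)
  then show "(x - u) - (y - v) \<in> \<int>" by (simp add: algebra_simps)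
qed

definition uniformity_circle :: "(circle \<times> circle) filter" where
  "uniformity_circle = (INF e\<in>{0<..}. principal {(x, y). dist x y < e})"

definition open_circle :: "circle set \<Rightarrow> bool" where
  "open_circle U \<longleftrightarrow> (\<forall>x\<in>U. eventually (\<lambda>(x', y). x' = x \<longrightarrow> y \<in> U) uniformity)"

instance
proof
  fix x y z :: circle
  show "dist x y = 0 \<longleftrightarrow> x = y"
  proof transfer
    fix x y :: real
    show "infdist (x - y) \<int> = 0 \<longleftrightarrow> x - y \<in> \<int>"
      using in_closed_iff_infdist_zero[of "\<int> :: real set" "x - y"] closed_Ints
      by (metis Ints_0 empty_iff)
  qed
  show "dist x y \<le> dist x z + dist y z"
  proof transfer
    fix x y z :: real
    obtain k :: real where k: "k \<in> \<int>" "infdist (x - z) \<int> = dist (x - z) k"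
      using infdist_attains_inf[of "\<int> :: real set" "x - z"] closed_Ints by (metis Ints_0 empty_iff)
    obtain l :: real where l: "l \<in> \<int>" "infdist (y - z) \<int> = dist (y - z) l"
      using infdist_attains_inf[of "\<int> :: real set" "y - z"] closed_Ints by (metis Ints_0 empty_iff)
    have "infdist (x - y) \<int> \<le> dist (x - y) (k - l)"
      by (rule infdist_le) (intro Ints_diff k l)
    also have "\<dots> \<le> dist (x - z) k + dist (y - z) l"
      unfolding dist_real_def by linarith
    finally show "infdist (x - y) \<int> \<le> infdist (x - z) \<int> + infdist (y - z) \<int>"
      by (simp add: k l)
  qed
qed (simp_all add: uniformity_circle_def open_circle_def)

end

(* Functions need not be differentiable, so derivatives are replaced by the lower and upper
   limits of the difference quotients; at an end point of an interval S these are one-sided. *)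
definition lower_deriv :: "(real \<Rightarrow> real) \<Rightarrow> real \<Rightarrow> real set \<Rightarrow> ereal" where
  "lower_deriv g x S = Liminf (at x within S) (\<lambda>y. ereal ((g y - g x) / (y - x)))"

definition upper_deriv :: "(real \<Rightarrow> real) \<Rightarrow> real \<Rightarrow> real set \<Rightarrow> ereal" where
  "upper_deriv g x S = Limsup (at x within S) (\<lambda>y. ereal ((g y - g x) / (y - x)))"

definition skew_product ::
  "real \<Rightarrow> (circle \<Rightarrow> real \<Rightarrow> real) \<Rightarrow> circle \<times> real \<Rightarrow> circle \<times> real" where
  "skew_product \<omega> f = (\<lambda>(\<theta>, x). (\<theta> + to_circle \<omega>, f \<theta> x))"

definition global_attractor ::
  "real \<Rightarrow> (circle \<times> real \<Rightarrow> circle \<times> real) \<Rightarrow> (circle \<times> real) set" where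
  "global_attractor L T = (\<Inter>n::nat. (T ^^ n) ` (UNIV \<times> {0..L}))"

definition upper_bounding_graph ::
  "real \<Rightarrow> (circle \<times> real \<Rightarrow> circle \<times> real) \<Rightarrow> circle \<Rightarrow> real" where
  "upper_bounding_graph L T \<theta> = (GREATEST x. x \<in> {0..L} \<and> (\<theta>, x) \<in> global_attractor L T)"

end

theory Submission
  imports Defs "HOL-Real_Asymp.Real_Asymp"
begin

text \<open>The upper bounding graph \<phi> is the decreasing limit of the iterated upper lines \<phi>_n of x = L.
  Each \<phi>_n is continuous, with Lipschitz constant of order \<alpha>^n, and vanishes at \<tau>_1, ..., \<tau>_n.
  Because an orbit recovers from a passage near the pinched fibre before it meets that fibre again,
  it spends most of its time in the contracting region x \<ge> 1; so \<phi>_(k-1) - \<phi>_k is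
  exponentially small in k except on balls of radius s^(2k) around \<tau>_1, ..., \<tau>_k.

  Given 0 < x \<le> \<phi>(\<theta>), choose \<tau>_n near \<theta>. For every N \<ge> n the line \<phi>_N takes the value x
  between \<tau>_n and \<theta>, and nearly this value on an arc of length of order \<alpha>^(-N). If this arc is not
  swallowed by the exceptional balls with k > N, then \<phi> is close to x at one of its points.
  Otherwise the arc is extremely close to some \<tau>_j with j comparable to N. Just outside the
  exceptional ball of \<tau>_j the graph is still at least about x, so the argument can be
  repeated between \<tau>_j and such a point with N' a large multiple of j. This time the arc is not
  swallowed, since by the Diophantine condition all other \<tau>_l with l comparable to j are
  only polynomially close to \<tau>_j.\<close>

section \<open>Distances on the circle and density of the rotation orbit\<close>

lemma to_circle_0: "to_circle 0 = 0"
  by (simp add: zero_circle_def)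

lemma to_circle_add: "to_circle (x + y) = to_circle x + to_circle y"
  by (simp add: plus_circle.abs_eq)

lemma to_circle_diff: "to_circle (x - y) = to_circle x - to_circle y"
  by (simp add: minus_circle.abs_eq)

lemma dist_circle_translate [simp]:
  fixes x y z :: circle
  shows "dist (x + z) (y + z) = dist x y" "dist (z + x) (z + y) = dist x y"
    "dist (x - z) (y - z) = dist x y"
  by (transfer, simp)+

lemma dist_circle_diff_0: "dist (x - y) (0 :: circle) = dist x y"
  using dist_circle_translate(3)[of x y y] by simp

lemma dist_to_circle_le: "dist (to_circle s) (to_circle t) \<le> \<bar>s - t\<bar>"
  using infdist_le[of 0 \<int> "s - t"] by (simp add: dist_circle.abs_eq)

text \<open>A nonzero integer shift cannot decrease an absolute value that is at most 1/2, so
  passing to the quotient does not shorten the distance.\<close>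

lemma dist_to_circle_eq:
  assumes "\<bar>s - t\<bar> \<le> 1 / 2"
  shows "dist (to_circle s) (to_circle t) = \<bar>s - t\<bar>"
proof -
  obtain k :: real where k: "k \<in> \<int>" "infdist (s - t) \<int> = dist (s - t) k"
    using infdist_attains_inf[of "\<int> :: real set" "s - t"] closed_Ints by (metis Ints_0 empty_iff)
  then obtain i :: int where i: "k = of_int i" by (auto elim: Ints_cases)
  have "\<bar>s - t\<bar> \<le> \<bar>s - t - of_int i\<bar>"
  proof (cases "i = 0")
    case False
    then have "1 \<le> \<bar>real_of_int i\<bar>" by linarith
    then show ?thesis using assms by linarith
  qed simp
  then have "\<bar>s - t\<bar> \<le> dist (to_circle s) (to_circle t)"
    using k i by (simp add: dist_circle.abs_eq dist_real_def)
  then show ?thesis using dist_to_circle_le[of s t] by simp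
qed

text \<open>Lets arguments on the circle run along a real parameter: \<open>t\<close> is the
  representative of \<open>y - x\<close> nearest to 0.\<close>

lemma circle_step:
  fixes x y :: circle
  obtains t where "y = x + to_circle t" "\<bar>t\<bar> = dist x y"
proof -
  have "\<exists>s. z = to_circle s" for z
    by (induct z rule: circle.abs_induct) auto
  then obtain s where s: "y - x = to_circle s" by blast
  obtain k :: real where k: "k \<in> \<int>" "infdist s \<int> = dist s k"
    using infdist_attains_inf[of "\<int> :: real set" s] closed_Ints by (metis Ints_0 empty_iff)
  have "to_circle (s - k) = to_circle s"
    using k(1) by (intro circle.abs_eq_iff[THEN iffD2]) simp
  moreover have "dist x y = dist (to_circle s) 0"
    using dist_circle_diff_0[of y x] s by (simp add: dist_commute)
  then have "dist x y = \<bar>s - k\<bar>"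
    using k(2) by (simp add: to_circle_0[symmetric] dist_circle.abs_eq dist_real_def)
  ultimately show thesis
    using that[of "s - k"] s by (metis add.commute diff_add_cancel)
qed

lemma dist_circle_le_half: "dist x (y :: circle) \<le> 1 / 2"
proof -
  obtain t where t: "y = x + to_circle t" "\<bar>t\<bar> = dist x y" by (rule circle_step)
  have "to_circle (t - of_int (round t)) = to_circle t"
    by (intro circle.abs_eq_iff[THEN iffD2]) simp
  then have "dist x y = dist (to_circle (t - of_int (round t))) (to_circle 0)"
    using t(1) dist_circle_translate(2)[of x 0 "to_circle t"] by (simp add: to_circle_0 dist_commute)
  also have "\<dots> \<le> \<bar>t - of_int (round t)\<bar>"
    using dist_to_circle_le[of _ 0] by simp
  also have "\<dots> \<le> 1 / 2"
    using of_int_round_abs_le[of t] by (simp add: abs_minus_commute)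
  finally show ?thesis .
qed

text \<open>Kronecker approximation of fractional parts, carried to the circle. The index is kept
  positive because the known zeros of the upper lines are orbit points of positive index.\<close>

lemma rotation_orbit_dense:
  fixes x :: circle
  assumes "\<omega> \<notin> \<rat>" "0 < e"
  obtains n :: nat where "1 \<le> n" "dist (to_circle (real n * \<omega>)) x < e"
proof -
  obtain t where t: "x = 0 + to_circle t" by (metis circle_step)
  obtain n :: nat where n: "0 < n" "\<bar>frac (real n * \<omega>) - frac t\<bar> < e"
    using Kronecker_approx_1_explicit[of \<omega> "frac t" e] assms frac_ge_0[of t] frac_lt_1[of t]
    by (metis less_imp_le)
  have "to_circle (frac u) = to_circle u" for u
    by (intro circle.abs_eq_iff[THEN iffD2]) (simp add: frac_def)
  then have "dist (to_circle (real n * \<omega>)) x < e"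
    using dist_to_circle_le[of "frac (real n * \<omega>)" "frac t"] n t by simp
  then show thesis using that[of n] n(1) by simp
qed

section \<open>Arcs that small balls cannot cover\<close>

text \<open>Countable subadditivity of Lebesgue measure: generation \<open>k\<close> consists of
  \<open>k\<close> intervals of length \<open>2 * r k\<close>, and all of them together are shorter
  than \<open>{u..v}\<close>.\<close>

lemma interval_not_covered:
  fixes c :: "nat \<Rightarrow> nat \<Rightarrow> real" and r :: "nat \<Rightarrow> real"
  assumes r: "\<And>k. 0 \<le> r k" and s: "summable (\<lambda>k. 2 * real k * r k)"
    and less: "(\<Sum>k. 2 * real k * r k) < v - u"
  shows "\<exists>t\<in>{u..v}. \<forall>k. \<forall>l\<in>{1..k}. r k < \<bar>t - c k l\<bar>"
proof (rule ccontr)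
  define B where "B k = (\<Union>l\<in>{1..k}. cball (c k l) (r k))" for k
  assume "\<not> ?thesis"
  then have sub: "{u..v} \<subseteq> (\<Union>k. B k)"
    unfolding B_def by (fastforce simp: dist_real_def abs_minus_commute not_less)
  have meas: "B k \<in> sets lborel" for k
    unfolding B_def by auto
  have "emeasure lborel (B k) \<le> ennreal (2 * real k * r k)" for k
  proof -
    have "emeasure lborel (B k) \<le> (\<Sum>l\<in>{1..k}. emeasure lborel (cball (c k l) (r k)))"
      unfolding B_def by (rule emeasure_subadditive_finite) auto
    also have "\<dots> = (\<Sum>l\<in>{1..k}. ennreal (2 * r k))"
      by (intro sum.cong refl) (use r in \<open>simp add: cball_eq_atLeastAtMost\<close>)
    also have "\<dots> = ennreal (2 * real k * r k)"
      using r by (simp add: ennreal_of_nat_eq_real_of_nat ennreal_mult'[symmetric] ac_simps)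
    finally show ?thesis .
  qed
  then have le: "(\<Sum>k. emeasure lborel (B k)) \<le> (\<Sum>k. ennreal (2 * real k * r k))"
    by (intro suminf_le) auto
  have "0 \<le> (\<Sum>k. 2 * real k * r k)" using r by (intro suminf_nonneg s) auto
  then have "u \<le> v" using less by linarith
  have "ennreal (v - u) = emeasure lborel {u..v}" using \<open>u \<le> v\<close> by simp
  also have "\<dots> \<le> emeasure lborel (\<Union>k. B k)" using sub meas by (intro emeasure_mono) auto
  also have "\<dots> \<le> (\<Sum>k. emeasure lborel (B k))"
    using meas by (intro emeasure_subadditive_countably) auto
  also have "\<dots> \<le> ennreal (\<Sum>k. 2 * real k * r k)"
    using le r s by (simp add: suminf_ennreal_eq[OF _ summable_sums])
  finally show False
    using less \<open>0 \<le> (\<Sum>k. 2 * real k * r k)\<close> by (simp add: ennreal_le_iff)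
qed

text \<open>On an arc of length at most 1/2 two points close to the same centre are close as reals, so
  each ball meets the arc in a set contained in an interval of twice its length.\<close>

lemma arc_not_covered:
  fixes p :: circle and q :: "nat \<Rightarrow> circle" and r :: "nat \<Rightarrow> real"
  assumes r: "\<And>k. 0 \<le> r k" and s: "summable (\<lambda>k. 4 * real k * r k)"
    and less: "(\<Sum>k. 4 * real k * r k) < v - u" and half: "v - u \<le> 1 / 2"
  obtains t where "t \<in> {u..v}" "\<And>k l. l \<in> {1..k} \<Longrightarrow> r k \<le> dist (p + to_circle t) (q l)"
proof -
  \<comment> \<open>If the ball misses the arc, the choice is arbitrary. This is harmless, since the
    defining property of \<open>c k l\<close> is used only after \<open>t\<close> itself has been
    found in the ball.\<close>
  define c where "c k l = (SOME t. t \<in> {u..v} \<and> dist (p + to_circle t) (q l) < r k)" for k l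
  have "\<exists>t\<in>{u..v}. \<forall>k. \<forall>l\<in>{1..k}. 2 * r k < \<bar>t - c k l\<bar>"
    by (rule interval_not_covered) (use r s less in \<open>simp_all add: mult.assoc mult.left_commute\<close>)
  then obtain t where t: "t \<in> {u..v}" "\<And>k l. l \<in> {1..k} \<Longrightarrow> 2 * r k < \<bar>t - c k l\<bar>"
    by blast
  have "r k \<le> dist (p + to_circle t) (q l)" if l: "l \<in> {1..k}" for k l
  proof (rule ccontr)
    assume "\<not> ?thesis"
    then have near: "dist (p + to_circle t) (q l) < r k" by simp
    then have "\<exists>t. t \<in> {u..v} \<and> dist (p + to_circle t) (q l) < r k" using t(1) by blast
    from someI_ex[OF this] have c: "c k l \<in> {u..v}" "dist (p + to_circle (c k l)) (q l) < r k"
      unfolding c_def by auto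
    have "\<bar>t - c k l\<bar> \<le> 1 / 2"
      using t(1) c(1) half unfolding atLeastAtMost_iff by linarith
    then have "\<bar>t - c k l\<bar> = dist (to_circle t) (to_circle (c k l))"
      by (rule dist_to_circle_eq[symmetric])
    also have "\<dots> = dist (p + to_circle t) (p + to_circle (c k l))" by simp
    also have "\<dots> < 2 * r k" using near c(2) dist_triangle2[of "p + to_circle t" _ "q l"]
      by (smt (verit))
    finally show False using t(2)[OF l] by simp
  qed
  then show thesis using that t(1) by blast
qed

text \<open>One factor \<open>s ^ k\<close> of \<open>s ^ (2 * k)\<close> absorbs the weight
  \<open>k\<close>, because \<open>k * s ^ k\<close> is bounded; the other one leaves a geometric
  tail.\<close>

lemma tail_sum_bound:
  fixes s :: real
  assumes s: "0 < s" "s < 1"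
  obtains C where "0 < C"
    "\<And>M. summable (\<lambda>k. 4 * real k * (if M < k then s ^ (2 * k) else 0))"
    "\<And>M. (\<Sum>k. 4 * real k * (if M < k then s ^ (2 * k) else 0)) \<le> C * s ^ M"
proof -
  have "(\<lambda>k. real k * s ^ k) \<longlonglongrightarrow> 0"
    using powser_times_n_limit_0[of s] s by simp
  then have "Bseq (\<lambda>k. real k * s ^ k)" by (meson convergentI convergent_imp_Bseq)
  then obtain B where B: "0 < B" "\<And>k. real k * s ^ k \<le> B"
    using s by (auto simp: Bseq_def)
  define g where "g M k = (if M < k then 4 * B * s ^ k else 0)" for M k
  have g: "g M sums (4 * B / (1 - s) * s ^ Suc M)" for M
  proof -
    have "(\<lambda>k. 4 * B * s ^ Suc M * s ^ k) sums (4 * B * s ^ Suc M * (1 / (1 - s)))"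
      using s by (intro sums_mult geometric_sums) auto
    moreover have "(\<lambda>k. 4 * B * s ^ Suc M * s ^ k) = (\<lambda>k. g M (k + Suc M))"
      by (auto simp: g_def power_add)
    ultimately have "g M sums (4 * B * s ^ Suc M * (1 / (1 - s)) + (\<Sum>k<Suc M. g M k))"
      using sums_iff_shift[of "g M" "Suc M"] by metis
    moreover have "(\<Sum>k<Suc M. g M k) = 0" by (rule sum.neutral) (auto simp: g_def)
    ultimately show ?thesis by simp
  qed
  have le: "4 * real k * (if M < k then s ^ (2 * k) else 0) \<le> g M k" for M k
    using mult_right_mono[OF B(2)[of k], of "s ^ k"] s
    by (simp add: g_def power_add mult_2 mult.assoc)
  have sm: "summable (\<lambda>k. 4 * real k * (if M < k then s ^ (2 * k) else 0))" for M
    by (rule summable_comparison_test'[OF sums_summable[OF g[of M]], of 0])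
      (use le[of _ M] s in auto)
  have "(\<Sum>k. 4 * real k * (if M < k then s ^ (2 * k) else 0)) \<le> (4 * B / (1 - s) * s) * s ^ M" for M
  proof -
    have "(\<Sum>k. 4 * real k * (if M < k then s ^ (2 * k) else 0)) \<le> suminf (g M)"
      by (rule suminf_le[OF le sm sums_summable[OF g]])
    then show ?thesis using sums_unique[OF g[of M]] by simp
  qed
  moreover have "0 < 4 * B / (1 - s) * s" using B s by simp
  ultimately show thesis using that[OF _ sm] by blast
qed

text \<open>Generations up to \<open>m\<close> get radius 0, so only the geometric tail counts
  against the length of the arc. The constant depends on \<open>s\<close> alone, not on the arc or
  the centres.\<close>

lemma arc_avoids_small_balls:
  fixes s :: real
  assumes s: "0 < s" "s < 1"
  obtains C where "0 < C"
    "\<And>m p q u v. C * s ^ m < v - u \<Longrightarrow> v - u \<le> 1 / 2 \<Longrightarrow>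
      \<exists>t\<in>{u..v}. \<forall>k>m. \<forall>l\<in>{1..k}. s ^ (2 * k) \<le> dist (p + to_circle t) (q l)"
proof -
  obtain C where C: "0 < C"
    "\<And>m. summable (\<lambda>k. 4 * real k * (if m < k then s ^ (2 * k) else 0))"
    "\<And>m. (\<Sum>k. 4 * real k * (if m < k then s ^ (2 * k) else 0)) \<le> C * s ^ m"
    using tail_sum_bound[OF s] by blast
  have "\<exists>t\<in>{u..v}. \<forall>k>m. \<forall>l\<in>{1..k}. s ^ (2 * k) \<le> dist (p + to_circle t) (q l)"
    if less: "C * s ^ m < v - u" and half: "v - u \<le> 1 / 2" for m p q u v
  proof -
    obtain t where t: "t \<in> {u..v}" "\<And>k l. l \<in> {1..k} \<Longrightarrow>
        (if m < k then s ^ (2 * k) else 0) \<le> dist (p + to_circle t) (q l)"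
    proof (rule arc_not_covered[where r = "\<lambda>k. if m < k then s ^ (2 * k) else 0" and p = p and q = q])
      show "summable (\<lambda>k. 4 * real k * (if m < k then s ^ (2 * k) else 0))" by (rule C(2))
      show "(\<Sum>k. 4 * real k * (if m < k then s ^ (2 * k) else 0)) < v - u"
        using C(3)[of m] less by linarith
    qed (use s half in auto)
    then show ?thesis by (intro bexI[OF _ t(1)]) (use t(2) in fastforce)
  qed
  then show thesis using that[OF C(1)] by blast
qed

section \<open>Lipschitz bounds from bounds on difference quotients\<close>

text \<open>Replaces the mean value theorem: the estimate is additive over adjacent intervals and
  holds on every short interval around a given point, so Bolzano's bisection principle makes it
  global.\<close>

lemma le_if_local_le:
  fixes g :: "real \<Rightarrow> real"
  assumes "u \<le> v"
    and loc: "\<And>x. x \<in> {u..v} \<Longrightarrow> \<forall>\<^sub>F y in at x within {u..v}. (g y - g x) / (y - x) < C"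
  shows "g v - g u \<le> C * (v - u)"
proof -
  have "u \<le> u \<and> v \<le> v \<longrightarrow> g v - g u \<le> C * (v - u)" using \<open>u \<le> v\<close>
  proof (rule Bolzano[where P = "\<lambda>y z. u \<le> y \<and> z \<le> v \<longrightarrow> g z - g y \<le> C * (z - y)"])
    fix x assume x: "u \<le> x" "x \<le> v"
    then obtain d where d: "0 < d"
      "\<And>y. y \<in> {u..v} \<Longrightarrow> y \<noteq> x \<Longrightarrow> dist y x < d \<Longrightarrow> (g y - g x) / (y - x) < C"
      using loc[of x] unfolding eventually_at by auto
    show "\<exists>d>0. \<forall>y z. y \<le> x \<and> x \<le> z \<and> z - y < d \<longrightarrow>
        u \<le> y \<and> z \<le> v \<longrightarrow> g z - g y \<le> C * (z - y)"
    proof (intro exI[of _ d] conjI allI impI d(1))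
      fix y z assume yz: "y \<le> x \<and> x \<le> z \<and> z - y < d" "u \<le> y \<and> z \<le> v"
      have "g z - g x \<le> C * (z - x)"
        using d(2)[of z] yz x by (cases "z = x") (auto simp: dist_real_def field_simps)
      moreover have "g x - g y \<le> C * (x - y)"
        using d(2)[of y] yz x by (cases "y = x") (auto simp: dist_real_def field_simps)
      ultimately show "g z - g y \<le> C * (z - y)" by (simp add: algebra_simps)
    qed
  qed (auto simp: algebra_simps)
  then show ?thesis by simp
qed

lemma le_if_upper_deriv_le:
  assumes "u \<le> v" "{u..v} \<subseteq> S" and up: "\<And>x. x \<in> {u..v} \<Longrightarrow> upper_deriv g x S \<le> ereal C"
  shows "g v - g u \<le> C * (v - u)"
proof (rule field_le_epsilon)
  fix e :: real assume e: "0 < e"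
  \<comment> \<open>A limsup bound controls the quotients only up to some slack \<open>e'\<close>.
    The summand 1 keeps the denominator positive when \<open>u = v\<close>.\<close>
  define e' where "e' = e / (v - u + 1)"
  have e': "0 < e'" "e' * (v - u) \<le> e"
    using e \<open>u \<le> v\<close> by (auto simp: e'_def field_simps)
  have "g v - g u \<le> (C + e') * (v - u)"
  proof (rule le_if_local_le[OF \<open>u \<le> v\<close>])
    fix x assume x: "x \<in> {u..v}"
    have "Limsup (at x within S) (\<lambda>y. ereal ((g y - g x) / (y - x))) < ereal (C + e')"
      using up[OF x] e' unfolding upper_deriv_def by (simp add: order_le_less_trans)
    from Limsup_lessD[OF this]
    have "\<forall>\<^sub>F y in at x within S. (g y - g x) / (y - x) < C + e'" by simp
    then show "\<forall>\<^sub>F y in at x within {u..v}. (g y - g x) / (y - x) < C + e'"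
      using at_le[OF assms(2)] by (rule filter_leD[rotated])
  qed
  then show "g v - g u \<le> C * (v - u) + e" using e' by (simp add: algebra_simps)
qed

lemma upper_deriv_uminus: "upper_deriv (\<lambda>t. - g t) x S = - lower_deriv g x S"
proof -
  have "(\<lambda>y. ereal ((- g y - - g x) / (y - x))) = (\<lambda>y. - ereal ((g y - g x) / (y - x)))"
    by (rule ext) (simp add: field_simps minus_divide_left)
  then show ?thesis
    by (simp add: upper_deriv_def lower_deriv_def ereal_Limsup_uminus del: uminus_ereal.simps)
qed

lemma upper_deriv_shift: "upper_deriv (\<lambda>t. g (x + t)) 0 UNIV = upper_deriv g x UNIV"
proof -
  have "at x = filtermap (\<lambda>t. x + t) (at (0::real))"
    using filtermap_at_shift[of "-x" 0] by (simp add: add.commute)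
  then show ?thesis by (simp add: upper_deriv_def Limsup_filtermap_eq)
qed

text \<open>The one-sided estimate is applied to \<open>g\<close> and to \<open>- g\<close> along a
  shortest arc from \<open>x\<close> to \<open>y\<close>.\<close>

lemma circle_lipschitz_if_derivs_le:
  fixes g :: "circle \<Rightarrow> real"
  assumes "\<And>\<theta>. upper_deriv (\<lambda>t. g (\<theta> + to_circle t)) 0 UNIV \<le> ereal C"
    and "\<And>\<theta>. ereal (- C) \<le> lower_deriv (\<lambda>t. g (\<theta> + to_circle t)) 0 UNIV"
  shows "\<bar>g x - g y\<bar> \<le> C * dist x y"
proof -
  have *: "h (\<theta> + to_circle v) - h (\<theta> + to_circle u) \<le> C * (v - u)"
    if h: "\<And>\<theta>. upper_deriv (\<lambda>t. h (\<theta> + to_circle t)) 0 UNIV \<le> ereal C" and "u \<le> v"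
    for h :: "circle \<Rightarrow> real" and \<theta> u v
  proof (rule le_if_upper_deriv_le[OF \<open>u \<le> v\<close> subset_UNIV, where g = "\<lambda>t. h (\<theta> + to_circle t)"])
    fix t
    show "upper_deriv (\<lambda>t. h (\<theta> + to_circle t)) t UNIV \<le> ereal C"
      using h[of "\<theta> + to_circle t"]
        upper_deriv_shift[of "\<lambda>t. h (\<theta> + to_circle t)" t]
      by (simp add: to_circle_add add.assoc)
  qed
  have neg: "upper_deriv (\<lambda>t. - g (\<theta> + to_circle t)) 0 UNIV \<le> ereal C" for \<theta>
    using assms(2)[of \<theta>] by (simp add: upper_deriv_uminus ereal_uminus_le_reorder)
  obtain t where t: "y = x + to_circle t" "\<bar>t\<bar> = dist x y" by (rule circle_step)
  have "\<bar>g (x + to_circle v) - g (x + to_circle u)\<bar> \<le> C * (v - u)" if "u \<le> v" for u v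
    using *[OF assms(1) that, of x] *[of "\<lambda>\<theta>. - g \<theta>", OF neg that, of x] by linarith
  from this[of 0 t] this[of t 0] show ?thesis
    unfolding t(2)[symmetric] unfolding t(1)
    by (cases "0 \<le> t") (auto simp: to_circle_0 abs_minus_commute)
qed

section \<open>Exponentials against powers\<close>

text \<open>Serves to place exponentially small distances below the polynomial separation of orbit
  points.\<close>

lemma power_eventually_less_powr:
  fixes K q c d :: real and B :: nat
  assumes "0 < q" "q < 1" "0 < c" "0 < B"
  shows "\<forall>\<^sub>F j in sequentially. K * q ^ j < c * real (B * j) powr - d"
proof -
  have "(\<lambda>j. K * q ^ j * (real B * real j) powr d) \<longlonglongrightarrow> 0"
    using assms by real_asymp
  then have "\<forall>\<^sub>F j in sequentially. K * q ^ j * (real B * real j) powr d < c"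
    using \<open>0 < c\<close> by (rule order_tendstoD(2))
  then show ?thesis
    using eventually_gt_at_top[of 0]
  proof eventually_elim
    case (elim j)
    then have "0 < (real B * real j) powr d" using assms by simp
    then show ?case using elim by (simp add: powr_minus field_simps)
  qed
qed

lemma power_eventually_le:
  fixes K q e :: real
  assumes "0 \<le> q" "q < 1" "0 < e"
  shows "\<forall>\<^sub>F j in sequentially. K * q ^ j \<le> e"
proof -
  have "(\<lambda>j. K * q ^ j) \<longlonglongrightarrow> K * 0"
    using assms by (intro tendsto_mult tendsto_const LIMSEQ_power_zero) auto
  then have "\<forall>\<^sub>F j in sequentially. K * q ^ j < e"
    using \<open>0 < e\<close> by (intro order_tendstoD(2)) auto
  then show ?thesis by (rule eventually_mono) simp
qed

section \<open>Iterated upper lines of a pinched skew product\<close>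

text \<open>The derivative bounds appear here as Lipschitz bounds, and the pinched fibre sits over
  0, so that its image under the first iterate lies over \<open>orb 1\<close>.\<close>

locale pinched_skew =
  fixes \<omega> L \<alpha> \<beta> c d :: real and f :: "circle \<Rightarrow> real \<Rightarrow> real"
  assumes L_pos: "0 < L"
    and irrational: "\<omega> \<notin> \<rat>"
    and fibre_range: "\<And>\<theta> x. x \<in> {0..L} \<Longrightarrow> f \<theta> x \<in> {0..L}"
    and fibre_mono: "\<And>\<theta> x y. 0 \<le> x \<Longrightarrow> x \<le> y \<Longrightarrow> y \<le> L \<Longrightarrow> f \<theta> x \<le> f \<theta> y"
    and fibre_zero: "\<And>\<theta>. f \<theta> 0 = 0"
    and pinched: "\<And>x. x \<in> {0..L} \<Longrightarrow> f 0 x = 0"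
    and alpha: "2 < \<alpha>"
    and fibre_lipschitz: "\<And>\<theta> x y. 0 \<le> x \<Longrightarrow> x \<le> y \<Longrightarrow> y \<le> L \<Longrightarrow> f \<theta> y - f \<theta> x \<le> \<alpha> * (y - x)"
    and beta: "0 < \<beta>"
    and base_lipschitz: "\<And>\<theta> \<theta>' x. x \<in> {0..L} \<Longrightarrow> \<bar>f \<theta> x - f \<theta>' x\<bar> \<le> \<beta> * dist \<theta> \<theta>'"
    and c_pos: "0 < c" and d_pos: "0 < d"
    and diophantine: "\<And>n :: nat. 1 \<le> n \<Longrightarrow>
      c * real n powr - d \<le> dist (to_circle (real n * \<omega>)) 0"
begin

abbreviation orb :: "nat \<Rightarrow> circle" where
  "orb n \<equiv> to_circle (real n * \<omega>)"

text \<open>\<open>ub n\<close> is the upper edge of the \<open>n\<close>-th image of the phase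
  space; rotating back by \<omega> expresses it over the target fibre.\<close>

primrec ub :: "nat \<Rightarrow> circle \<Rightarrow> real" where
  "ub 0 \<theta> = L"
| "ub (Suc n) \<theta> = f (\<theta> - to_circle \<omega>) (ub n (\<theta> - to_circle \<omega>))"

definition graph :: "circle \<Rightarrow> real" where
  "graph \<theta> = (INF n. ub n \<theta>)"

lemma orb_Suc: "orb (Suc n) = orb n + to_circle \<omega>"
  by (simp add: to_circle_add[symmetric] algebra_simps)

lemma dist_orb: "i \<le> j \<Longrightarrow> dist (orb i) (orb j) = dist (orb (j - i)) 0"
  using dist_circle_diff_0[of "orb j" "orb i"]
  by (simp add: to_circle_diff[symmetric] of_nat_diff dist_commute left_diff_distrib)

text \<open>The distance depends only on the difference of the indices, which is at most
  \<open>B\<close>, and the Diophantine bound decreases in it.\<close>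

lemma orb_separated:
  assumes "i \<noteq> j" "i \<le> B" "j \<le> B"
  shows "c * real B powr - d \<le> dist (orb i) (orb j)"
proof -
  have *: "c * real B powr - d \<le> dist (orb i) (orb j)" if "i < j" "j \<le> B" for i j
  proof -
    have "real B powr - d \<le> real (j - i) powr - d"
      using that d_pos by (intro powr_mono2') auto
    then have "c * real B powr - d \<le> c * real (j - i) powr - d" using c_pos by simp
    also have "\<dots> \<le> dist (orb i) (orb j)"
      using diophantine[of "j - i"] dist_orb[of i j] that by simp
    finally show ?thesis .
  qed
  show ?thesis
    using *[of i j] *[of j i] assms by (cases "i < j") (auto simp: dist_commute)
qed

lemma ub_range: "0 \<le> ub n \<theta>" "ub n \<theta> \<le> L"
proof -
  have "ub n \<theta> \<in> {0..L}"
    by (induction n arbitrary: \<theta>) (use L_pos fibre_range in auto)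
  then show "0 \<le> ub n \<theta>" "ub n \<theta> \<le> L" by auto
qed

lemma ub_antimono: "m \<le> n \<Longrightarrow> ub n \<theta> \<le> ub m \<theta>"
proof -
  have "ub (Suc n) \<theta> \<le> ub n \<theta>" for n \<theta>
  proof (induction n arbitrary: \<theta>)
    case 0
    show ?case using ub_range(2)[of "Suc 0" \<theta>] by simp
  next
    case (Suc n)
    show ?case
      using fibre_mono[OF ub_range(1) Suc ub_range(2)] by simp
  qed
  then show "m \<le> n \<Longrightarrow> ub n \<theta> \<le> ub m \<theta>"
    using lift_Suc_antimono_le[of "\<lambda>n. ub n \<theta>"] by simp
qed

text \<open>The pinched fibre sends the line to 0, and every later fibre map fixes 0.\<close>

lemma ub_orb:
  assumes "1 \<le> j" "j \<le> n"
  shows "ub n (orb j) = 0"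
  using assms
proof (induction n arbitrary: j)
  case (Suc n)
  obtain i where i: "j = Suc i" using Suc.prems by (cases j) auto
  have eq: "orb j - to_circle \<omega> = orb i" unfolding i orb_Suc by simp
  show ?case
  proof (cases "i = 0")
    case True
    then show ?thesis using eq ub_range[of n 0] by (simp add: to_circle_0 pinched)
  next
    case False
    then show ?thesis using eq Suc.IH[of i] Suc.prems i by (simp add: fibre_zero)
  qed
qed simp

lemma ub_lipschitz: "\<bar>ub n \<theta> - ub n \<theta>'\<bar> \<le> \<beta> * \<alpha> ^ n * dist \<theta> \<theta>'"
proof -
  \<comment> \<open>The subtracted 1 makes room for the new error \<beta> of each step:
    \<open>\<alpha> * (\<alpha> ^ n - 1) + 1 \<le> \<alpha> ^ Suc n - 1\<close> because \<alpha> is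
    at least 2.\<close>
  have "\<bar>ub n \<theta> - ub n \<theta>'\<bar> \<le> \<beta> * (\<alpha> ^ n - 1) * dist \<theta> \<theta>'"
  proof (induction n arbitrary: \<theta> \<theta>')
    case (Suc n)
    let ?p = "\<theta> - to_circle \<omega>" and ?q = "\<theta>' - to_circle \<omega>"
    have fl: "\<bar>f \<psi> x - f \<psi> y\<bar> \<le> \<alpha> * \<bar>x - y\<bar>" if "x \<in> {0..L}" "y \<in> {0..L}" for \<psi> x y
    proof (cases "x \<le> y")
      case True
      then show ?thesis
        using fibre_lipschitz[of x y \<psi>] fibre_mono[of x y \<psi>] that by (simp add: abs_minus_commute)
    next
      case False
      then show ?thesis using fibre_lipschitz[of y x \<psi>] fibre_mono[of y x \<psi>] that by simp
    qed
    have "\<bar>ub (Suc n) \<theta> - ub (Suc n) \<theta>'\<bar>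
        \<le> \<bar>f ?p (ub n ?p) - f ?q (ub n ?p)\<bar> + \<bar>f ?q (ub n ?p) - f ?q (ub n ?q)\<bar>"
      by simp
    also have "\<dots> \<le> \<beta> * dist \<theta> \<theta>' + \<alpha> * (\<beta> * (\<alpha> ^ n - 1) * dist \<theta> \<theta>')"
    proof (rule add_mono)
      show "\<bar>f ?p (ub n ?p) - f ?q (ub n ?p)\<bar> \<le> \<beta> * dist \<theta> \<theta>'"
        using base_lipschitz[of "ub n ?p" ?p ?q] ub_range[of n ?p] by simp
      have "\<bar>f ?q (ub n ?p) - f ?q (ub n ?q)\<bar> \<le> \<alpha> * \<bar>ub n ?p - ub n ?q\<bar>"
        using ub_range by (intro fl) auto
      also have "\<dots> \<le> \<alpha> * (\<beta> * (\<alpha> ^ n - 1) * dist \<theta> \<theta>')"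
        using Suc[of ?p ?q] alpha by (intro mult_left_mono) auto
      finally show "\<bar>f ?q (ub n ?p) - f ?q (ub n ?q)\<bar> \<le> \<alpha> * (\<beta> * (\<alpha> ^ n - 1) * dist \<theta> \<theta>')" .
    qed
    also have "\<dots> = \<beta> * (\<alpha> ^ Suc n + 1 - \<alpha>) * dist \<theta> \<theta>'" by (simp add: algebra_simps)
    also have "\<dots> \<le> \<beta> * (\<alpha> ^ Suc n - 1) * dist \<theta> \<theta>'"
      using alpha beta by (intro mult_right_mono mult_left_mono) auto
    finally show ?case .
  qed simp
  also have "\<dots> \<le> \<beta> * \<alpha> ^ n * dist \<theta> \<theta>'"
    using beta by (intro mult_right_mono mult_left_mono) auto
  finally show ?thesis .
qed

lemma ub_le_dist: "1 \<le> j \<Longrightarrow> ub j \<theta> \<le> \<beta> * \<alpha> ^ j * dist \<theta> (orb j)"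
  using ub_lipschitz[of j \<theta> "orb j"] ub_orb[of j j] by simp

lemma continuous_on_ub: "continuous_on S (ub n)"
proof -
  have "(\<beta> * \<alpha> ^ n)-lipschitz_on S (ub n)"
    by (rule lipschitz_onI) (use ub_lipschitz alpha beta in \<open>auto simp: dist_real_def\<close>)
  then show ?thesis by (rule lipschitz_on_continuous_on)
qed

text \<open>The intermediate value theorem along a shortest arc from \<open>p\<close> to
  \<open>q\<close>, which keeps \<open>r\<close> no farther from \<open>p\<close> than
  \<open>q\<close> is.\<close>

lemma ub_crossing:
  assumes "ub n p \<le> y" "y \<le> ub n q"
  obtains r where "dist p r \<le> dist p q" "ub n r = y"
proof -
  obtain t where t: "q = p + to_circle t" "\<bar>t\<bar> = dist p q" by (rule circle_step)
  have "continuous_on {0..1} (\<lambda>u. ub n (p + to_circle (u * t)))"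
  proof -
    have "(\<beta> * \<alpha> ^ n * \<bar>t\<bar>)-lipschitz_on {0..1} (\<lambda>u. ub n (p + to_circle (u * t)))"
    proof (rule lipschitz_onI)
      fix u v :: real
      have "dist (ub n (p + to_circle (u * t))) (ub n (p + to_circle (v * t)))
          \<le> \<beta> * \<alpha> ^ n * dist (to_circle (u * t)) (to_circle (v * t))"
        using ub_lipschitz[of n "p + to_circle (u * t)" "p + to_circle (v * t)"]
        by (simp add: dist_real_def)
      also have "\<dots> \<le> \<beta> * \<alpha> ^ n * \<bar>u * t - v * t\<bar>"
        using beta alpha by (intro mult_left_mono dist_to_circle_le) auto
      also have "\<dots> = \<beta> * \<alpha> ^ n * \<bar>t\<bar> * dist u v"
        by (simp add: dist_real_def left_diff_distrib[symmetric] abs_mult)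
      finally show "dist (ub n (p + to_circle (u * t))) (ub n (p + to_circle (v * t)))
          \<le> \<beta> * \<alpha> ^ n * \<bar>t\<bar> * dist u v" .
    qed (use alpha beta in simp)
    then show ?thesis by (rule lipschitz_on_continuous_on)
  qed
  from IVT'[OF _ _ _ this, of y] assms t
  obtain u where u: "0 \<le> u" "u \<le> 1" "ub n (p + to_circle (u * t)) = y"
    by (auto simp: to_circle_0)
  have "dist p (p + to_circle (u * t)) = dist (to_circle 0) (to_circle (u * t))"
    using dist_circle_translate(2)[of p 0] by (simp add: to_circle_0)
  also have "\<dots> \<le> u * \<bar>t\<bar>" using dist_to_circle_le[of 0 "u * t"] u by (simp add: abs_mult)
  also have "\<dots> \<le> \<bar>t\<bar>" using u by (intro mult_left_le_one_le) auto
  finally show thesis using that u(3) t(2) by metis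
qed

section \<open>The limit graph and the global attractor\<close>

lemma bdd_below_ub: "bdd_below (range (\<lambda>n. ub n \<theta>))"
  using ub_range(1) by (auto simp: bdd_below_def)

lemma graph_le_ub: "graph \<theta> \<le> ub n \<theta>"
  unfolding graph_def by (rule cINF_lower[OF bdd_below_ub]) simp

lemma graph_nonneg: "0 \<le> graph \<theta>"
  unfolding graph_def by (rule cINF_greatest) (use ub_range in auto)

lemma graph_orb: "1 \<le> j \<Longrightarrow> graph (orb j) = 0"
  using graph_le_ub[of "orb j" j] graph_nonneg[of "orb j"] ub_orb[of j j] by simp

lemma le_graph:
  assumes "\<And>n. N \<le> n \<Longrightarrow> y \<le> ub n \<theta>"
  shows "y \<le> graph \<theta>"
  unfolding graph_def
proof (rule cINF_greatest)
  fix n show "y \<le> ub n \<theta>"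
    using assms[of "max N n"] ub_antimono[of n "max N n" \<theta>] by simp
qed simp

text \<open>A continuous increasing fibre map that fixes 0 carries the segment below
  \<open>ub n\<close> onto the whole segment below \<open>ub (Suc n)\<close>; the intermediate value
  theorem gives surjectivity.\<close>

lemma funpow_skew_product_image:
  "(skew_product \<omega> f ^^ n) ` (UNIV \<times> {0..L}) = {(\<theta>, x). 0 \<le> x \<and> x \<le> ub n \<theta>}"
proof (induction n)
  case (Suc n)
  have "skew_product \<omega> f ` {(\<theta>, x). 0 \<le> x \<and> x \<le> ub n \<theta>} = {(\<theta>, x). 0 \<le> x \<and> x \<le> ub (Suc n) \<theta>}"
  proof (intro equalityI subsetI)
    fix z assume "z \<in> skew_product \<omega> f ` {(\<theta>, x). 0 \<le> x \<and> x \<le> ub n \<theta>}"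
    then obtain \<theta> x where z: "z = (\<theta> + to_circle \<omega>, f \<theta> x)" "0 \<le> x" "x \<le> ub n \<theta>"
      by (auto simp: skew_product_def)
    then show "z \<in> {(\<theta>, x). 0 \<le> x \<and> x \<le> ub (Suc n) \<theta>}"
      using fibre_mono[of x "ub n \<theta>" \<theta>] fibre_range[of x \<theta>] ub_range[of n \<theta>] by auto
  next
    fix z assume "z \<in> {(\<theta>, x). 0 \<le> x \<and> x \<le> ub (Suc n) \<theta>}"
    then obtain \<theta> y where z: "z = (\<theta>, y)" "0 \<le> y" "y \<le> ub (Suc n) \<theta>" by auto
    define \<psi> where "\<psi> = \<theta> - to_circle \<omega>"
    have "\<alpha>-lipschitz_on {0..ub n \<psi>} (f \<psi>)"
    proof (rule lipschitz_on_leI)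
      fix x y assume "x \<in> {0..ub n \<psi>}" "y \<in> {0..ub n \<psi>}" "x \<le> y"
      then show "dist (f \<psi> x) (f \<psi> y) \<le> \<alpha> * dist x y"
        using fibre_lipschitz[of x y \<psi>] fibre_mono[of x y \<psi>] ub_range[of n \<psi>]
        by (simp add: dist_real_def)
    qed (use alpha in simp)
    then have "continuous_on {0..ub n \<psi>} (f \<psi>)" by (rule lipschitz_on_continuous_on)
    from IVT'[OF _ _ _ this, of y] z ub_range[of n \<psi>]
    obtain x where "0 \<le> x" "x \<le> ub n \<psi>" "f \<psi> x = y" by (auto simp: fibre_zero \<psi>_def)
    then show "z \<in> skew_product \<omega> f ` {(\<theta>, x). 0 \<le> x \<and> x \<le> ub n \<theta>}"
      using z by (intro image_eqI[of _ _ "(\<psi>, x)"]) (auto simp: skew_product_def \<psi>_def)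
  qed
  then show ?case by (simp only: funpow.simps(2) image_comp[symmetric] Suc)
qed auto

lemma global_attractor_eq:
  "global_attractor L (skew_product \<omega> f) = {(\<theta>, x). 0 \<le> x \<and> x \<le> graph \<theta>}"
proof -
  have "x \<le> graph \<theta> \<longleftrightarrow> (\<forall>n. x \<le> ub n \<theta>)" for \<theta> x
    using graph_le_ub[of \<theta>] le_graph[of 0 x \<theta>] order.trans by blast
  then show ?thesis unfolding global_attractor_def funpow_skew_product_image by auto
qed

lemma upper_bounding_graph_eq: "upper_bounding_graph L (skew_product \<omega> f) = graph"
proof (rule ext)
  fix \<theta>
  show "upper_bounding_graph L (skew_product \<omega> f) \<theta> = graph \<theta>"
    unfolding upper_bounding_graph_def global_attractor_eq
    by (rule Greatest_equality) (use graph_nonneg graph_le_ub[of \<theta> 0] in auto)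
qed

text \<open>The region below \<open>graph\<close> is the intersection of the regions below the
  continuous lines \<open>ub n\<close>.\<close>

lemma closed_subgraph: "closed {(\<theta>, x). 0 \<le> x \<and> x \<le> graph \<theta>}"
proof -
  have "closed {z :: circle \<times> real. 0 \<le> snd z \<and> snd z \<le> ub n (fst z)}" for n
    by (intro closed_Collect_conj closed_Collect_le continuous_intros
        continuous_on_compose2[OF continuous_on_ub]) auto
  then have "closed (\<Inter>n. {z :: circle \<times> real. 0 \<le> snd z \<and> snd z \<le> ub n (fst z)})"
    by blast
  moreover have "x \<le> graph \<theta> \<longleftrightarrow> (\<forall>n. x \<le> ub n \<theta>)" for \<theta> x
    using graph_le_ub[of \<theta>] le_graph[of 0 x \<theta>] order.trans by blast
  then have "{(\<theta>, x). 0 \<le> x \<and> x \<le> graph \<theta>} =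
      (\<Inter>n. {z :: circle \<times> real. 0 \<le> snd z \<and> snd z \<le> ub n (fst z)})"
    by auto
  ultimately show ?thesis by simp
qed

end

section \<open>The closure of the graph, given exponential contraction\<close>

text \<open>The decay away from the exceptional balls is an assumption here and is derived from
  steepness further below. The integer \<open>A\<close> links the scales: \<open>s ^ (A * n)\<close>
  beats the square of the growth \<open>\<alpha> ^ n\<close> of the Lipschitz constants.\<close>

locale contracting_pinched_skew = pinched_skew +
  fixes s M \<rho> :: real and A :: nat
  assumes s: "0 < s" "s < 1" and lam: "0 < \<rho>" "\<rho> < 1" and M: "0 \<le> M"
    and A: "1 \<le> A" "s ^ A * \<alpha>\<^sup>2 \<le> 1"
    and contraction: "\<And>k \<theta>. 1 \<le> k \<Longrightarrow> (\<And>j. j \<in> {1..k} \<Longrightarrow> s ^ (2 * k) \<le> dist \<theta> (orb j)) \<Longrightarrow>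
      ub (k - 1) \<theta> - ub k \<theta> \<le> M * \<rho> ^ k"
begin

text \<open>Telescoping: \<open>M * \<rho> ^ n\<close> is a difference of consecutive values of
  \<open>M / (1 - \<rho>) * \<rho> ^ n\<close>.\<close>

lemma ub_close_to_graph:
  assumes "\<And>k j. N < k \<Longrightarrow> j \<in> {1..k} \<Longrightarrow> s ^ (2 * k) \<le> dist \<theta> (orb j)"
  shows "ub N \<theta> - M / (1 - \<rho>) * \<rho> ^ N \<le> graph \<theta>"
proof (rule le_graph)
  fix n assume "N \<le> n"
  then have "ub N \<theta> - ub n \<theta> \<le> M / (1 - \<rho>) * (\<rho> ^ N - \<rho> ^ n)"
  proof (induction n rule: dec_induct)
    case (step n)
    have "ub n \<theta> - ub (Suc n) \<theta> \<le> M * \<rho> ^ Suc n"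
      using contraction[of "Suc n" \<theta>] assms[of "Suc n"] step.hyps by simp
    also have "\<dots> \<le> M * \<rho> ^ n"
      using lam M by (intro mult_left_mono power_decreasing) auto
    also have "\<dots> = M / (1 - \<rho>) * (\<rho> ^ n - \<rho> ^ Suc n)"
      using lam by (simp add: field_simps)
    finally show ?case using step.IH by (simp add: algebra_simps)
  qed simp
  also have "\<dots> \<le> M / (1 - \<rho>) * \<rho> ^ N"
    using lam M by (intro mult_left_mono) auto
  finally show "ub N \<theta> - M / (1 - \<rho>) * \<rho> ^ N \<le> ub n \<theta>" by simp
qed

lemma s_pow_A_alpha: "s ^ (A * n) * \<alpha> ^ (2 * n) \<le> 1"
proof -
  have "(s ^ A * \<alpha>\<^sup>2) ^ n \<le> 1"
    using A s alpha by (intro power_le_one) auto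
  then show ?thesis by (simp add: power_mult_distrib power_mult)
qed

lemma s_pow_A_alpha': "s ^ (A * n) * \<alpha> ^ n \<le> 1"
proof -
  have "s ^ (A * n) * \<alpha> ^ n \<le> s ^ (A * n) * \<alpha> ^ (2 * n)"
    using s alpha by (intro mult_left_mono power_increasing) auto
  then show ?thesis using s_pow_A_alpha[of n] by simp
qed

text \<open>The point where an upper line takes a given value lies in an arc, of length comparable to
  the inverse of the Lipschitz constant, on which the line is nearly constant. The exceptional
  balls of generation beyond A * N are too small to cover this arc, so only a ball around an
  orbit point of index comparable to N can prevent the graph from being close to the line.\<close>

lemma near_crossing:
  assumes e: "0 < e"
  obtains N0 where "\<And>N \<theta>. N0 \<le> N \<Longrightarrow> 2 * e \<le> ub N \<theta> \<Longrightarrow>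
    \<exists>\<theta>'. dist \<theta> \<theta>' \<le> e / \<beta> * (1 / \<alpha>) ^ N \<and> \<bar>ub N \<theta>' - ub N \<theta>\<bar> \<le> e \<and>
      (ub N \<theta>' - e \<le> graph \<theta>' \<or>
       (\<exists>j. 1 \<le> j \<and> N \<le> A * j \<and> j \<le> A * N \<and> dist \<theta>' (orb j) < s ^ (2 * max j N)))"
proof -
  obtain C where C: "0 < C" "\<And>m p q u v. C * s ^ m < v - u \<Longrightarrow> v - u \<le> 1 / 2 \<Longrightarrow>
      \<exists>t\<in>{u..v}. \<forall>k>m. \<forall>l\<in>{1..k}. s ^ (2 * k) \<le> dist (p + to_circle t) (q l)"
    using arc_avoids_small_balls[OF s] by blast
  have "\<forall>\<^sub>F N in sequentially. e / \<beta> * (1 / \<alpha>) ^ N \<le> 1 / 4 \<and>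
      C * \<beta> * (1 / \<alpha>) ^ N \<le> e \<and> M / (1 - \<rho>) * \<rho> ^ N \<le> e \<and> \<beta> * s ^ N \<le> e / 2"
    using e s lam alpha by (intro eventually_conj power_eventually_le) auto
  then obtain N0 where N0: "\<And>N. N0 \<le> N \<Longrightarrow> e / \<beta> * (1 / \<alpha>) ^ N \<le> 1 / 4"
    "\<And>N. N0 \<le> N \<Longrightarrow> C * \<beta> * (1 / \<alpha>) ^ N \<le> e"
    "\<And>N. N0 \<le> N \<Longrightarrow> M / (1 - \<rho>) * \<rho> ^ N \<le> e"
    "\<And>N. N0 \<le> N \<Longrightarrow> \<beta> * s ^ N \<le> e / 2"
    unfolding eventually_sequentially by blast
  show thesis
  proof (rule that)
    fix N \<theta> assume N: "N0 \<le> N" and big: "2 * e \<le> ub N \<theta>"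
    \<comment> \<open>The radius within which \<open>ub N\<close>, having Lipschitz constant
      \<open>\<beta> * \<alpha> ^ N\<close>, changes by at most \<open>e\<close>.\<close>
    define \<delta> where "\<delta> = e / \<beta> * (1 / \<alpha>) ^ N"
    have \<delta>: "0 < \<delta>" "\<delta> \<le> 1 / 4" "\<beta> * \<alpha> ^ N * \<delta> = e"
      using e beta alpha N0(1)[OF N] by (auto simp: \<delta>_def power_divide)
    have "C * s ^ (A * N) < \<delta> - - \<delta>"
    proof -
      have "s ^ (A * N) \<le> (1 / \<alpha>) ^ (2 * N)"
        using s_pow_A_alpha[of N] alpha by (simp add: power_divide field_simps)
      then have "C * s ^ (A * N) \<le> C * (1 / \<alpha>) ^ N * (1 / \<alpha>) ^ N"
        using C(1) by (simp add: mult_2 power_add)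
      also have "\<dots> \<le> e / \<beta> * (1 / \<alpha>) ^ N"
        using N0(2)[OF N] beta alpha by (intro mult_right_mono) (auto simp: field_simps)
      also have "\<dots> < \<delta> - - \<delta>" using \<delta>(1) unfolding \<delta>_def[symmetric] by simp
      finally show ?thesis .
    qed
    then obtain t where t: "t \<in> {- \<delta>..\<delta>}" and
      avoid: "\<And>k l. A * N < k \<Longrightarrow> l \<in> {1..k} \<Longrightarrow> s ^ (2 * k) \<le> dist (\<theta> + to_circle t) (orb l)"
      using C(2)[of "A * N" \<delta> "- \<delta>" \<theta> orb] \<delta>(2) by auto
    define \<theta>' where "\<theta>' = \<theta> + to_circle t"
    have "dist \<theta> \<theta>' = dist (to_circle 0) (to_circle t)"
      using dist_circle_translate(2)[of \<theta> 0] by (simp add: \<theta>'_def to_circle_0)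
    also have "\<dots> \<le> \<delta>" using dist_to_circle_le[of 0 t] t unfolding atLeastAtMost_iff by linarith
    finally have near: "dist \<theta> \<theta>' \<le> \<delta>" .
    have "\<bar>ub N \<theta>' - ub N \<theta>\<bar> \<le> \<beta> * \<alpha> ^ N * dist \<theta> \<theta>'"
      using ub_lipschitz[of N \<theta>' \<theta>] by (simp add: dist_commute)
    also have "\<dots> \<le> \<beta> * \<alpha> ^ N * \<delta>" using near beta alpha by (intro mult_left_mono) auto
    finally have val: "\<bar>ub N \<theta>' - ub N \<theta>\<bar> \<le> e" using \<delta>(3) by simp
    have "ub N \<theta>' - e \<le> graph \<theta>' \<or>
       (\<exists>j. 1 \<le> j \<and> N \<le> A * j \<and> j \<le> A * N \<and> dist \<theta>' (orb j) < s ^ (2 * max j N))"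
    proof (cases "\<exists>k j. N < k \<and> j \<in> {1..k} \<and> dist \<theta>' (orb j) < s ^ (2 * k)")
      case False
      then have "ub N \<theta>' - M / (1 - \<rho>) * \<rho> ^ N \<le> graph \<theta>'"
        by (intro ub_close_to_graph) (force simp: not_less)
      then show ?thesis using N0(3)[OF N] by linarith
    next
      case True
      then obtain k j where kj: "N < k" "j \<in> {1..k}" "dist \<theta>' (orb j) < s ^ (2 * k)" by blast
      have k: "k \<le> A * N"
        using avoid[OF _ kj(2)] kj(3) by (fastforce simp: \<theta>'_def not_less[symmetric])
      \<comment> \<open>For a smaller \<open>j\<close>, the zero of \<open>ub j\<close> at
        \<open>orb j\<close> would force \<open>ub j \<theta>'\<close>, and with it
        \<open>ub N \<theta>'\<close>, below \<open>e\<close>.\<close>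
      have j: "N \<le> A * j"
      proof (rule ccontr)
        assume "\<not> ?thesis"
        then have less: "A * j < N" by simp
        then have "j \<le> N" using A(1) by (metis less_imp_le mult_le_mono1 nat_mult_1 order.trans)
        have "e \<le> ub N \<theta>'" using val big by linarith
        also have "\<dots> \<le> ub j \<theta>'" by (rule ub_antimono[OF \<open>j \<le> N\<close>])
        also have "\<dots> \<le> \<beta> * \<alpha> ^ j * dist \<theta>' (orb j)" using kj(2) by (intro ub_le_dist) auto
        also have "\<dots> \<le> \<beta> * \<alpha> ^ j * s ^ (N + A * j)"
        proof (rule mult_left_mono)
          have "s ^ (2 * k) \<le> s ^ (N + A * j)"
            using less kj(1) s by (intro power_decreasing) auto
          then show "dist \<theta>' (orb j) \<le> s ^ (N + A * j)" using kj(3) by linarith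
        qed (use beta alpha in auto)
        also have "\<dots> = \<beta> * s ^ N * (s ^ (A * j) * \<alpha> ^ j)" by (simp add: power_add)
        also have "\<dots> \<le> \<beta> * s ^ N"
          using s_pow_A_alpha'[of j] beta s by (intro mult_left_le) auto
        finally show False using N0(4)[OF N] e by linarith
      qed
      have "s ^ (2 * k) \<le> s ^ (2 * max j N)"
        using kj s by (intro power_decreasing) auto
      then show ?thesis using j k kj by (intro disjI2 exI[of _ j]) auto
    qed
    then show "\<exists>\<theta>'. dist \<theta> \<theta>' \<le> e / \<beta> * (1 / \<alpha>) ^ N \<and> \<bar>ub N \<theta>' - ub N \<theta>\<bar> \<le> e \<and>
      (ub N \<theta>' - e \<le> graph \<theta>' \<or>
       (\<exists>j. 1 \<le> j \<and> N \<le> A * j \<and> j \<le> A * N \<and> dist \<theta>' (orb j) < s ^ (2 * max j N)))"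
      using near val unfolding \<delta>_def by blast
  qed
qed

text \<open>Up to two rounds of crossings. The first, at level \<open>N\<close> between
  \<open>orb n\<close> and \<theta>, yields \<open>\<theta>0\<close> and \<open>\<theta>1\<close>.
  If a ball around \<open>orb j\<close> swallows \<open>\<theta>1\<close>, a point
  \<open>\<theta>2\<close> just outside replaces \<theta>, and a round at level \<open>N'\<close>
  between \<open>orb j\<close> and \<open>\<theta>2\<close> yields \<open>\<theta>3\<close> and
  \<open>\<theta>4\<close>.\<close>

lemma graph_takes_values_near:
  assumes x: "0 < x" "x \<le> graph \<theta>" and e: "0 < e"
  obtains \<psi> where "dist \<theta> \<psi> < e" "\<bar>graph \<psi> - x\<bar> < e"
proof -
  \<comment> \<open>All errors add up to at most \<open>6 * \<epsilon>\<close>, and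
    \<open>x - 3 * \<epsilon>\<close> stays above the threshold \<open>2 * \<epsilon>\<close> needed
    in the second round.\<close>
  define \<epsilon> where "\<epsilon> = min (x / 8) (e / 16)"
  have eps: "0 < \<epsilon>" "8 * \<epsilon> \<le> x" "16 * \<epsilon> \<le> e"
    using x e by (auto simp: \<epsilon>_def)
  obtain N0 where N0: "\<And>N \<theta>. N0 \<le> N \<Longrightarrow> 2 * \<epsilon> \<le> ub N \<theta> \<Longrightarrow>
    \<exists>\<theta>'. dist \<theta> \<theta>' \<le> \<epsilon> / \<beta> * (1 / \<alpha>) ^ N \<and> \<bar>ub N \<theta>' - ub N \<theta>\<bar> \<le> \<epsilon> \<and>
      (ub N \<theta>' - \<epsilon> \<le> graph \<theta>' \<or>
       (\<exists>j. 1 \<le> j \<and> N \<le> A * j \<and> j \<le> A * N \<and> dist \<theta>' (orb j) < s ^ (2 * max j N)))"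
    using near_crossing[OF eps(1)] by blast
  obtain C where C: "0 < C" "\<And>m p q u v. C * s ^ m < v - u \<Longrightarrow> v - u \<le> 1 / 2 \<Longrightarrow>
      \<exists>t\<in>{u..v}. \<forall>k>m. \<forall>l\<in>{1..k}. s ^ (2 * k) \<le> dist (p + to_circle t) (q l)"
    using arc_avoids_small_balls[OF s] by blast
  \<comment> \<open>The root turns decay in \<open>k\<close> into decay in \<open>j\<close>:
    \<open>s ^ k \<le> \<sigma> ^ j\<close> as soon as \<open>A * k \<ge> j\<close>.\<close>
  obtain \<sigma> where \<sigma>: "0 < \<sigma>" "\<sigma> < 1" "\<sigma> ^ A = s"
  proof (rule that)
    show "root A s ^ A = s" using A s by (intro real_root_pow_pos2) auto
    show "0 < root A s" "root A s < 1" using A s by auto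
  qed
  have "\<forall>\<^sub>F i in sequentially. M / (1 - \<rho>) * \<rho> ^ i \<le> \<epsilon>"
    using lam eps by (intro power_eventually_le) auto
  then obtain I0 where I0: "\<And>i. I0 \<le> i \<Longrightarrow> M / (1 - \<rho>) * \<rho> ^ i \<le> \<epsilon>"
    unfolding eventually_sequentially by blast
  have "\<forall>\<^sub>F j in sequentially. (3 * \<beta> * s ^ j \<le> \<epsilon> \<and> C * s ^ j \<le> 1 / 2) \<and>
      (4 * s ^ j \<le> min \<epsilon> 1 \<and> \<epsilon> / \<beta> * (1 / \<alpha>) ^ j \<le> \<epsilon>) \<and>
      (3 * \<sigma> ^ j < c * real (3 * j) powr - d \<and>
       6 * s ^ j < c * real (2 * A * A * j) powr - d \<and>
       2 * \<epsilon> / \<beta> * (1 / \<alpha>) ^ j < c * real (2 * A * A * j) powr - d)"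
    using s \<sigma> alpha beta eps c_pos A
    by (intro eventually_conj power_eventually_le power_eventually_less_powr) auto
  then obtain J0 where J0: "\<And>j. J0 \<le> j \<Longrightarrow> 3 * \<beta> * s ^ j \<le> \<epsilon> \<and> C * s ^ j \<le> 1 / 2"
    "\<And>j. J0 \<le> j \<Longrightarrow> 4 * s ^ j \<le> min \<epsilon> 1"
    "\<And>j. J0 \<le> j \<Longrightarrow> \<epsilon> / \<beta> * (1 / \<alpha>) ^ j \<le> \<epsilon>"
    "\<And>j. J0 \<le> j \<Longrightarrow> 3 * \<sigma> ^ j < c * real (3 * j) powr - d"
    "\<And>j. J0 \<le> j \<Longrightarrow> 6 * s ^ j < c * real (2 * A * A * j) powr - d"
    "\<And>j. J0 \<le> j \<Longrightarrow> 2 * \<epsilon> / \<beta> * (1 / \<alpha>) ^ j < c * real (2 * A * A * j) powr - d"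
    unfolding eventually_sequentially by blast
  obtain n where n: "1 \<le> n" "dist (orb n) \<theta> < \<epsilon>"
    using rotation_orbit_dense[OF irrational eps(1)] by blast
  \<comment> \<open>The multiples of \<open>A\<close> are there because \<open>j\<close> will only
    be known to satisfy \<open>N \<le> A * j\<close>; they ensure \<open>J0 \<le> j\<close> and
    \<open>I0 \<le> j div A\<close>.\<close>
  define N where "N = Max {n, N0, J0, A * J0, A * (A * I0)}"
  have N: "n \<le> N" "N0 \<le> N" "J0 \<le> N" "A * J0 \<le> N" "A * (A * I0) \<le> N"
    by (simp_all add: N_def)
  have "x \<le> ub N \<theta>" using x(2) graph_le_ub[of \<theta> N] by linarith
  then obtain \<theta>0 where \<theta>0: "dist (orb n) \<theta>0 \<le> dist (orb n) \<theta>" "ub N \<theta>0 = x"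
    using ub_crossing[of N "orb n" x \<theta>] ub_orb[OF n(1) N(1)] x(1) by auto
  have "2 * \<epsilon> \<le> ub N \<theta>0" using \<theta>0(2) eps by linarith
  from N0[OF N(2) this] obtain \<theta>1 where
    \<theta>1: "dist \<theta>0 \<theta>1 \<le> \<epsilon> / \<beta> * (1 / \<alpha>) ^ N" "\<bar>ub N \<theta>1 - x\<bar> \<le> \<epsilon>" and
    cases1: "ub N \<theta>1 - \<epsilon> \<le> graph \<theta>1 \<or>
      (\<exists>j. 1 \<le> j \<and> N \<le> A * j \<and> j \<le> A * N \<and> dist \<theta>1 (orb j) < s ^ (2 * max j N))"
    unfolding \<theta>0(2) by blast
  have "dist \<theta>0 \<theta>1 \<le> \<epsilon>" using \<theta>1(1) J0(3)[OF N(3)] by linarith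
  then have d1: "dist \<theta> \<theta>1 \<le> 3 * \<epsilon>"
    using n(2) \<theta>0(1) dist_triangle[of \<theta> \<theta>1 \<theta>0] dist_triangle3[of \<theta> \<theta>0 "orb n"] by linarith
  from cases1 show thesis
  proof
    assume "ub N \<theta>1 - \<epsilon> \<le> graph \<theta>1"
    then have "\<bar>graph \<theta>1 - x\<bar> \<le> 2 * \<epsilon>" using \<theta>1(2) graph_le_ub[of \<theta>1 N] by linarith
    then show thesis using that[of \<theta>1] d1 eps by linarith
  next
    assume "\<exists>j. 1 \<le> j \<and> N \<le> A * j \<and> j \<le> A * N \<and> dist \<theta>1 (orb j) < s ^ (2 * max j N)"
    then obtain j where j: "1 \<le> j" "N \<le> A * j" "j \<le> A * N" "dist \<theta>1 (orb j) < s ^ (2 * max j N)"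
      by blast
    have "A * J0 \<le> A * j" "A * (A * I0) \<le> A * j" using N j(2) by linarith+
    then have jJ: "J0 \<le> j" and jI: "A * I0 \<le> j" using A(1) by auto
    \<comment> \<open>An intermediate level: low enough that \<open>s ^ j\<close> compensates the
      growth \<open>\<alpha> ^ i\<close>, so \<open>ub i\<close> hardly changes from
      \<open>\<theta>1\<close> to \<open>\<theta>2\<close>, and high enough that \<open>ub i\<close>
      is close to the graph at \<open>\<theta>2\<close>.\<close>
    define i where "i = j div A"
    have i: "I0 \<le> i" "A * i \<le> j" "j < A * Suc i" "i \<le> N"
    proof -
      show "A * i \<le> j" by (simp add: i_def)
      show "j < A * Suc i" using dividend_less_times_div[of A j] A(1) by (simp add: i_def)
      show "I0 \<le> i" using div_le_mono[OF jI, of A] A(1) by (simp add: i_def)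
      show "i \<le> N" using div_le_mono[OF j(3), of A] A(1) by (simp add: i_def)
    qed
    have sj: "0 < s ^ (2 * j)" "s ^ (2 * j) \<le> s ^ j" "4 * s ^ j \<le> \<epsilon>" "4 * s ^ j \<le> 1"
      using s J0(2)[OF jJ] by (auto intro: power_decreasing)
    have "s ^ (2 * max j N) \<le> s ^ (2 * j)" using s by (intro power_decreasing) auto
    then have \<theta>1j: "dist \<theta>1 (orb j) \<le> s ^ (2 * j)" using j(4) by linarith
    \<comment> \<open>On the arc at distance between \<open>s ^ (2 * j)\<close> and twice that from
      \<open>orb j\<close>, the generations beyond \<open>3 * j\<close> are negligible.\<close>
    have "C * s ^ (3 * j) < 2 * s ^ (2 * j) - s ^ (2 * j)"
    proof -
      have "C * s ^ (3 * j) = (C * s ^ j) * s ^ (2 * j)" by (simp add: power_add[symmetric])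
      also have "\<dots> \<le> 1 / 2 * s ^ (2 * j)"
        using J0(1)[OF jJ] sj(1) by (intro mult_right_mono) auto
      finally show ?thesis using sj(1) by linarith
    qed
    moreover have "2 * s ^ (2 * j) - s ^ (2 * j) \<le> 1 / 2" using sj by linarith
    ultimately obtain t where t: "t \<in> {s ^ (2 * j)..2 * s ^ (2 * j)}" and
      avoid: "\<And>k l. 3 * j < k \<Longrightarrow> l \<in> {1..k} \<Longrightarrow> s ^ (2 * k) \<le> dist (orb j + to_circle t) (orb l)"
      using C(2)[of "3 * j" "2 * s ^ (2 * j)" "s ^ (2 * j)" "orb j" orb] by blast
    define \<theta>2 where "\<theta>2 = orb j + to_circle t"
    have "dist (orb j) \<theta>2 = dist (to_circle 0) (to_circle t)"
      using dist_circle_translate(2)[of "orb j" 0] by (simp add: \<theta>2_def to_circle_0)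
    also have "\<dots> = t" using dist_to_circle_eq[of 0 t] t sj by simp
    finally have \<theta>2j: "dist (orb j) \<theta>2 = t" .
    have "dist \<theta>1 \<theta>2 \<le> 3 * s ^ (2 * j)"
      using dist_triangle[of \<theta>1 \<theta>2 "orb j"] \<theta>1j \<theta>2j t by simp
    have "\<bar>ub i \<theta>2 - ub i \<theta>1\<bar> \<le> \<epsilon>"
    proof -
      have "\<bar>ub i \<theta>2 - ub i \<theta>1\<bar> \<le> \<beta> * \<alpha> ^ i * dist \<theta>1 \<theta>2"
        using ub_lipschitz[of i \<theta>2 \<theta>1] by (simp add: dist_commute)
      also have "\<dots> \<le> \<beta> * \<alpha> ^ i * (3 * s ^ (2 * j))"
        using \<open>dist \<theta>1 \<theta>2 \<le> _\<close> beta alpha by (intro mult_left_mono) auto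
      also have "\<dots> = 3 * \<beta> * s ^ j * (s ^ j * \<alpha> ^ i)" by (simp add: mult_2 power_add)
      also have "\<dots> \<le> 3 * \<beta> * s ^ j * 1"
      proof (rule mult_left_mono)
        have "s ^ j * \<alpha> ^ i \<le> s ^ (A * i) * \<alpha> ^ i"
          using i(2) s alpha by (intro mult_right_mono power_decreasing) auto
        then show "s ^ j * \<alpha> ^ i \<le> 1" using s_pow_A_alpha'[of i] by linarith
      qed (use beta s in auto)
      finally show ?thesis using J0(1)[OF jJ] by simp
    qed
    moreover have "ub i \<theta>2 - M / (1 - \<rho>) * \<rho> ^ i \<le> graph \<theta>2"
    proof (rule ub_close_to_graph)
      fix k l assume k: "i < k" and l: "l \<in> {1..k}"
      \<comment> \<open>Late generations are avoided by the choice of \<open>t\<close>, the centre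
        \<open>orb j\<close> by the distance kept from it, and the remaining centres by Diophantine
        separation from \<open>orb j\<close>.\<close>
      consider "3 * j < k" | "l = j" | "k \<le> 3 * j" "l \<noteq> j" by linarith
      then show "s ^ (2 * k) \<le> dist \<theta>2 (orb l)"
      proof cases
        case 1
        then show ?thesis using avoid[OF _ l] by (simp add: \<theta>2_def)
      next
        case 2
        then have "s ^ (2 * k) \<le> s ^ (2 * j)" using l s by (intro power_decreasing) auto
        then show ?thesis using 2 \<theta>2j t by (simp add: dist_commute)
      next
        case 3
        have "A * Suc i \<le> A * k" using k by (intro mult_le_mono2) simp
        then have "\<sigma> ^ (A * k) \<le> \<sigma> ^ j" using i(3) \<sigma> by (intro power_decreasing) auto
        then have "s ^ k \<le> \<sigma> ^ j" using \<sigma>(3) by (simp add: power_mult)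
        moreover have "s ^ (2 * k) \<le> s ^ k" using s by (intro power_decreasing) auto
        moreover have "\<sigma> ^ (A * j) \<le> \<sigma> ^ j" using \<sigma> A(1) by (intro power_decreasing) auto
        then have "s ^ j \<le> \<sigma> ^ j" using \<sigma>(3) by (simp add: power_mult)
        moreover have "c * real (3 * j) powr - d \<le> dist (orb l) (orb j)"
          using 3 l by (intro orb_separated) auto
        moreover have "dist (orb l) (orb j) \<le> dist \<theta>2 (orb l) + dist (orb j) \<theta>2"
          using dist_triangle[of "orb l" "orb j" \<theta>2] by (simp add: dist_commute)
        ultimately show ?thesis using J0(4)[OF jJ] \<theta>2j t sj(2) by simp
      qed
    qed
    moreover have "x - \<epsilon> \<le> ub i \<theta>1"
      using \<theta>1(2) ub_antimono[OF i(4), of \<theta>1] by linarith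
    ultimately have \<theta>2_graph: "x - 3 * \<epsilon> \<le> graph \<theta>2" using I0[OF i(1)] by linarith
    \<comment> \<open>With the factor 2, every \<open>l\<close> with \<open>N' \<le> A * l\<close>
      is at least \<open>2 * j\<close>, so \<open>orb j\<close> cannot be the obstruction
      again.\<close>
    define N' where "N' = 2 * A * j"
    have N': "N0 \<le> N'" "j \<le> N'" using N(2) j(2) A(1) by (auto simp: N'_def)
    have "x - 3 * \<epsilon> \<le> ub N' \<theta>2" using \<theta>2_graph graph_le_ub[of \<theta>2 N'] by linarith
    then obtain \<theta>3 where \<theta>3: "dist (orb j) \<theta>3 \<le> dist (orb j) \<theta>2" "ub N' \<theta>3 = x - 3 * \<epsilon>"
      using ub_crossing[of N' "orb j" "x - 3 * \<epsilon>" \<theta>2] ub_orb[OF j(1) N'(2)] eps by auto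
    have "2 * \<epsilon> \<le> ub N' \<theta>3" using \<theta>3(2) eps by linarith
    from N0[OF N'(1) this] obtain \<theta>4 where
      \<theta>4: "dist \<theta>3 \<theta>4 \<le> \<epsilon> / \<beta> * (1 / \<alpha>) ^ N'" "\<bar>ub N' \<theta>4 - (x - 3 * \<epsilon>)\<bar> \<le> \<epsilon>" and
      cases4: "ub N' \<theta>4 - \<epsilon> \<le> graph \<theta>4 \<or>
        (\<exists>l. 1 \<le> l \<and> N' \<le> A * l \<and> l \<le> A * N' \<and> dist \<theta>4 (orb l) < s ^ (2 * max l N'))"
      unfolding \<theta>3(2) by blast
    have "(1 / \<alpha>) ^ N' \<le> (1 / \<alpha>) ^ j" using N'(2) alpha by (intro power_decreasing) auto
    then have "\<epsilon> / \<beta> * (1 / \<alpha>) ^ N' \<le> \<epsilon> / \<beta> * (1 / \<alpha>) ^ j"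
      using eps beta by (intro mult_left_mono) auto
    then have d34: "dist \<theta>3 \<theta>4 \<le> \<epsilon> / \<beta> * (1 / \<alpha>) ^ j" using \<theta>4(1) by linarith
    have d4: "dist (orb j) \<theta>4 \<le> 2 * s ^ (2 * j) + \<epsilon> / \<beta> * (1 / \<alpha>) ^ j"
      using dist_triangle[of "orb j" \<theta>4 \<theta>3] \<theta>3(1) \<theta>2j t d34 by simp
    \<comment> \<open>A second obstruction \<open>orb l\<close> would be exponentially close to
      \<open>orb j\<close> although \<open>l \<noteq> j\<close> and \<open>l\<close> is at most
      \<open>2 * A * A * j\<close>.\<close>
    have "\<not> (\<exists>l. 1 \<le> l \<and> N' \<le> A * l \<and> l \<le> A * N' \<and> dist \<theta>4 (orb l) < s ^ (2 * max l N'))"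
    proof
      assume "\<exists>l. 1 \<le> l \<and> N' \<le> A * l \<and> l \<le> A * N' \<and> dist \<theta>4 (orb l) < s ^ (2 * max l N')"
      then obtain l where l: "N' \<le> A * l" "l \<le> A * N'" "dist \<theta>4 (orb l) < s ^ (2 * max l N')"
        by blast
      have "A * (2 * j) \<le> A * l" using l(1) by (simp add: N'_def ac_simps)
      then have "l \<noteq> j" using j(1) A(1) by auto
      have "j \<le> A * N'" using N'(2) A(1) by (metis mult_le_mono nat_mult_1)
      then have "c * real (2 * A * A * j) powr - d \<le> dist (orb j) (orb l)"
        using \<open>l \<noteq> j\<close> l(2) by (intro orb_separated) (auto simp: N'_def ac_simps)
      also have "\<dots> \<le> dist (orb j) \<theta>4 + dist \<theta>4 (orb l)" by (rule dist_triangle)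
      also have "s ^ (2 * max l N') \<le> s ^ (2 * j)"
        using s N'(2) by (intro power_decreasing) auto
      then have "dist (orb j) \<theta>4 + dist \<theta>4 (orb l) \<le> 3 * s ^ j + \<epsilon> / \<beta> * (1 / \<alpha>) ^ j"
        using d4 l(3) sj(2) by linarith
      finally show False using J0(5,6)[OF jJ] by simp
    qed
    then have "ub N' \<theta>4 - \<epsilon> \<le> graph \<theta>4" using cases4 by blast
    then have "\<bar>graph \<theta>4 - x\<bar> \<le> 5 * \<epsilon>"
      using \<theta>4(2) graph_le_ub[of \<theta>4 N'] by linarith
    moreover have "dist \<theta> \<theta>4 \<le> 6 * \<epsilon>"
      using d1 \<theta>1j d4 J0(3)[OF jJ] sj dist_triangle[of \<theta> \<theta>4 \<theta>1] dist_triangle[of \<theta>1 \<theta>4 "orb j"]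
      by linarith
    ultimately show thesis using that[of \<theta>4] eps by linarith
  qed
qed

text \<open>The subgraph is closed; conversely, the dense orbit of zeros approximates points with
  \<open>x = 0\<close>, and the preceding lemma those with \<open>x > 0\<close>.\<close>

lemma closure_graph:
  "closure {(\<theta>, graph \<theta>) | \<theta>. True} = {(\<theta>, x). 0 \<le> x \<and> x \<le> graph \<theta>}"
proof (rule closure_unique)
  show "{(\<theta>, graph \<theta>) | \<theta>. True} \<subseteq> {(\<theta>, x). 0 \<le> x \<and> x \<le> graph \<theta>}"
    using graph_nonneg by auto
  show "closed {(\<theta>, x). 0 \<le> x \<and> x \<le> graph \<theta>}" by (rule closed_subgraph)
  fix F assume F: "{(\<theta>, graph \<theta>) | \<theta>. True} \<subseteq> F" "closed F"
  show "{(\<theta>, x). 0 \<le> x \<and> x \<le> graph \<theta>} \<subseteq> F"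
  proof clarify
    fix \<theta> x assume x: "0 \<le> x" "x \<le> graph \<theta>"
    have "(\<theta>, x) \<in> closure F"
      unfolding closure_approachable
    proof (intro allI impI)
      fix e :: real assume e: "0 < e"
      have "\<exists>\<psi>. dist \<theta> \<psi> < e / 2 \<and> \<bar>graph \<psi> - x\<bar> < e / 2"
      proof (cases "x = 0")
        case True
        obtain n where "1 \<le> n" "dist (orb n) \<theta> < e / 2"
          using rotation_orbit_dense[OF irrational, of "e / 2"] e by (metis half_gt_zero)
        then show ?thesis
          using True e by (intro exI[of _ "orb n"]) (auto simp: graph_orb dist_commute)
      next
        case False
        then show ?thesis
          using graph_takes_values_near[of x \<theta> "e / 2"] x e by (metis half_gt_zero less_eq_real_def)
      qed
      then obtain \<psi> where \<psi>: "dist \<theta> \<psi> < e / 2" "\<bar>graph \<psi> - x\<bar> < e / 2" by blast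
      have "dist (\<psi>, graph \<psi>) (\<theta>, x) \<le> dist \<psi> \<theta> + dist (graph \<psi>) x"
        unfolding dist_Pair_Pair by (rule sqrt_sum_squares_le_sum) auto
      also have "\<dots> < e" using \<psi> by (simp add: dist_real_def dist_commute)
      finally show "\<exists>y\<in>F. dist y (\<theta>, x) < e" using F(1) by blast
    qed
    then show "(\<theta>, x) \<in> F" using F(2) by simp
  qed
qed

end

section \<open>Close visits to the pinched fibre and the contraction rate\<close>

text \<open>Each block of \<open>g\<close> consecutive integers contains at most one element of
  \<open>X\<close>.\<close>

lemma card_le_if_gaps:
  fixes X :: "nat set" and g n :: nat
  assumes "X \<subseteq> {..<n}" "0 < g" and gap: "\<And>x y. x \<in> X \<Longrightarrow> y \<in> X \<Longrightarrow> x < y \<Longrightarrow> g \<le> y - x"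
  shows "real (card X) \<le> 1 + real n / real g"
proof -
  have less: "x div g < y div g" if "x \<in> X" "y \<in> X" "x < y" for x y
  proof -
    have "x + g \<le> y" using gap[OF that] that(3) by linarith
    then have "(x + g) div g \<le> y div g" by (rule div_le_mono)
    then show ?thesis using \<open>0 < g\<close> by simp
  qed
  have "inj_on (\<lambda>x. x div g) X"
  proof (rule inj_onI)
    fix x y assume "x \<in> X" "y \<in> X" "x div g = y div g"
    then show "x = y" using less[of x y] less[of y x] by (cases x y rule: linorder_cases) auto
  qed
  moreover have "(\<lambda>x. x div g) ` X \<subseteq> {..n div g}"
  proof
    fix z assume "z \<in> (\<lambda>x. x div g) ` X"
    then obtain x where "x < n" "z = x div g" using assms(1) by blast
    then show "z \<in> {..n div g}" by (simp add: div_le_mono less_imp_le)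
  qed
  ultimately have "card X \<le> card {..n div g}"
    using card_inj_on_le[of "\<lambda>x. x div g" X "{..n div g}"] by simp
  then have "real (card X) \<le> 1 + real (n div g)" by simp
  also have "\<dots> \<le> 1 + real n / real g" using of_nat_div_le_of_nat[of n g] by simp
  finally show ?thesis .
qed

locale steep_pinched_skew = pinched_skew +
  fixes \<gamma> a b :: real and m :: nat
  assumes gamma: "0 < \<gamma>" and L_ge_1: "1 \<le> L"
    and fibre_contracts: "\<And>\<theta> x y. 1 \<le> x \<Longrightarrow> x \<le> y \<Longrightarrow> y \<le> L \<Longrightarrow>
      f \<theta> y - f \<theta> x \<le> \<alpha> powr - \<gamma> * (y - x)"
    and m: "4 + 4 / \<gamma> < real m"
    and a: "(real m + 1) powr d \<le> a"
    and b: "0 < b" "b \<le> c" "b \<le> 1"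
    and orb_far: "\<And>n. n \<in> {1..m - 1} \<Longrightarrow> b \<le> dist (orb n) 0"
    and steep: "\<And>\<theta> x. x \<in> {0..L} \<Longrightarrow> min 1 (a * x) * min 1 (2 / b * dist \<theta> 0) \<le> f \<theta> x"
begin

lemma m_pos: "0 < m"
  using m gamma by (cases m) (auto simp: field_simps)

lemma a_gt_1: "1 < a"
proof -
  have "1 < (real m + 1) powr d" using m_pos d_pos by (intro gr_one_powr) auto
  then show ?thesis using a by linarith
qed

text \<open>The number of scales, truncated at \<open>Q\<close>, on which \<theta> is close to the
  pinched fibre. Counting scales lets a sum of depths along an orbit be rearranged into visits per
  scale.\<close>

definition depth :: "nat \<Rightarrow> circle \<Rightarrow> nat" where
  "depth Q \<theta> = card {q \<in> {..<Q}. dist \<theta> 0 < b / 2 * (1 / a) ^ q}"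

text \<open>The scales that are hit form an initial segment, so a failure would make one more scale
  hit than \<open>depth\<close> counts. The assumption rules out that truncation hides further
  scales.\<close>

lemma depth_bound:
  assumes "b / 2 * (1 / a) ^ Q \<le> dist \<theta> 0"
  shows "(1 / a) ^ depth Q \<theta> \<le> min 1 (2 / b * dist \<theta> 0)"
proof (rule ccontr)
  let ?S = "{q \<in> {..<Q}. dist \<theta> 0 < b / 2 * (1 / a) ^ q}" and ?k = "depth Q \<theta>"
  assume "\<not> ?thesis"
  moreover have "(1 / a) ^ ?k \<le> 1" using a_gt_1 by (intro power_le_one) auto
  ultimately have lt: "dist \<theta> 0 < b / 2 * (1 / a) ^ ?k"
    using b by (simp add: min_def field_simps split: if_splits)
  have "?k \<le> card {..<Q}" unfolding depth_def by (intro card_mono) auto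
  moreover have "?k \<noteq> Q" using lt assms by auto
  ultimately have "?k < Q" by simp
  have "{..?k} \<subseteq> ?S"
  proof
    fix q assume "q \<in> {..?k}"
    then have "(1 / a) ^ ?k \<le> (1 / a) ^ q" using a_gt_1 by (intro power_decreasing) auto
    then have "b / 2 * (1 / a) ^ ?k \<le> b / 2 * (1 / a) ^ q" using b by simp
    then show "q \<in> ?S" using lt \<open>?k < Q\<close> \<open>q \<in> _\<close> by simp
  qed
  then have "card {..?k} \<le> ?k" unfolding depth_def by (intro card_mono) auto
  then show False by simp
qed

text \<open>Two visits at scale \<open>q\<close> make \<open>orb (j - i)\<close> return within
  \<open>b * (1 / a) ^ q\<close> of 0. For \<open>q = 0\<close> the separation of the first orbit
  points applies; for larger \<open>q\<close> the Diophantine bound does, where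
  \<open>a \<ge> (m + 1) powr d\<close> turns \<open>a ^ q\<close> into the gap
  \<open>(m + 1) ^ q\<close>.\<close>

lemma hits_gap:
  assumes "i < j" and i: "dist \<theta> (orb i) < b / 2 * (1 / a) ^ q"
    and j: "dist \<theta> (orb j) < b / 2 * (1 / a) ^ q"
  shows "(if q = 0 then m else (m + 1) ^ q) \<le> j - i"
proof -
  have "dist (orb (j - i)) 0 = dist (orb i) (orb j)" using dist_orb[of i j] assms(1) by simp
  also have "\<dots> < b * (1 / a) ^ q" using i j dist_triangle3[of "orb i" "orb j" \<theta>] by linarith
  finally have lt: "dist (orb (j - i)) 0 < b * (1 / a) ^ q" .
  show ?thesis
  proof (cases "q = 0")
    case True
    then show ?thesis using lt orb_far[of "j - i"] assms(1) by force
  next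
    case False
    have "c * real (j - i) powr - d < b * (1 / a) ^ q"
      using assms(1) by (intro order_le_less_trans[OF diophantine lt]) simp
    also have "\<dots> \<le> c * (1 / a) ^ q" using b a_gt_1 by (intro mult_right_mono) auto
    finally have "real (j - i) powr - d < (1 / a) ^ q" using c_pos by simp
    then have "a ^ q < real (j - i) powr d"
      using a_gt_1 assms(1) by (simp add: powr_minus power_divide field_simps)
    moreover have "real ((m + 1) ^ q) powr d = ((real m + 1) powr d) ^ q"
      by (simp add: powr_powr powr_realpow[symmetric] mult.commute add.commute)
    moreover have "((real m + 1) powr d) ^ q \<le> a ^ q" using a by (intro power_mono) auto
    ultimately have "real ((m + 1) ^ q) powr d < real (j - i) powr d" by linarith
    then have "real ((m + 1) ^ q) < real (j - i)"
      using powr_mono2[of d "real (j - i)" "real ((m + 1) ^ q)"] d_pos by linarith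
    then show ?thesis using False by (simp only: of_nat_less_iff if_False less_imp_le)
  qed
qed

text \<open>The full series is 1/m from \<open>q = 0\<close> plus 1/m from the geometric series of
  ratio 1/(m + 1); the explicit remainder makes the induction work.\<close>

lemma sum_inverse_gaps:
  "(\<Sum>q<Suc Q. 1 / real (if q = 0 then m else (m + 1) ^ q)) = 2 / m - 1 / m * (1 / (real m + 1)) ^ Q"
proof (induction Q)
  case (Suc Q)
  let ?r = "1 / (real m + 1)"
  have "1 - ?r = real m * ?r" by (simp add: field_simps)
  then have "1 / m * (1 - ?r) = ?r" using m_pos by simp
  then have r: "?r = 1 / m - 1 / m * ?r" by (simp only: right_diff_distrib mult_1_right)
  have "(\<Sum>q<Suc (Suc Q). 1 / real (if q = 0 then m else (m + 1) ^ q))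
      = 2 / m - 1 / m * ?r ^ Q + ?r * ?r ^ Q"
  proof -
    have "1 / real (if Suc Q = 0 then m else (m + 1) ^ Suc Q) = ?r * ?r ^ Q"
      by (simp add: power_divide algebra_simps)
    then show ?thesis unfolding sum.lessThan_Suc[of _ "Suc Q"] Suc by simp
  qed
  also have "\<dots> = 2 / m - 1 / m * ?r ^ Q + (1 / m - 1 / m * ?r) * ?r ^ Q" by (simp only: r[symmetric])
  also have "\<dots> = 2 / m - 1 / m * ?r ^ Suc Q" by (simp add: algebra_simps)
  finally show ?case .
qed simp

text \<open>Double counting over times and scales: at scale \<open>q\<close> the gaps allow at most
  \<open>1 + n / g q\<close> visits.\<close>

lemma sum_depth_le:
  "real (\<Sum>j<n. depth Q (\<theta> - orb (Suc j))) \<le> real Q + 2 * real n / real m"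
proof -
  define g where "g q = (if q = 0 then m else (m + 1) ^ q)" for q
  define X where "X q = {j \<in> {..<n}. dist \<theta> (orb (Suc j)) < b / 2 * (1 / a) ^ q}" for q
  have "(\<Sum>j<n. depth Q (\<theta> - orb (Suc j))) =
      (\<Sum>j<n. \<Sum>q<Q. if dist \<theta> (orb (Suc j)) < b / 2 * (1 / a) ^ q then 1 else 0)"
    by (simp add: depth_def dist_circle_diff_0 sum.If_cases Int_def)
  also have "\<dots> = (\<Sum>q<Q. \<Sum>j<n. if dist \<theta> (orb (Suc j)) < b / 2 * (1 / a) ^ q then 1 else 0)"
    by (rule sum.swap)
  also have "\<dots> = (\<Sum>q<Q. card (X q))"
    by (simp add: X_def sum.If_cases Int_def)
  finally have "real (\<Sum>j<n. depth Q (\<theta> - orb (Suc j))) = (\<Sum>q<Q. real (card (X q)))" by simp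
  also have "\<dots> \<le> (\<Sum>q<Q. 1 + real n / real (g q))"
  proof (intro sum_mono card_le_if_gaps)
    fix q i j assume "i \<in> X q" "j \<in> X q" "i < j"
    then show "g q \<le> j - i" using hits_gap[of "Suc i" "Suc j" \<theta> q] by (simp add: X_def g_def)
  qed (use m_pos in \<open>auto simp: X_def g_def\<close>)
  also have "\<dots> = real Q + real n * (\<Sum>q<Q. 1 / real (g q))"
    by (simp add: sum.distrib sum_distrib_left)
  also have "(\<Sum>q<Q. 1 / real (g q)) \<le> 2 / real m"
  proof (cases Q)
    case (Suc Q')
    then show ?thesis using sum_inverse_gaps[of Q'] by (simp add: g_def)
  qed simp
  then have "real Q + real n * (\<Sum>q<Q. 1 / real (g q)) \<le> real Q + real n * (2 / real m)"
    by (intro add_left_mono mult_left_mono) auto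
  finally show ?thesis by (simp add: mult.commute)
qed

text \<open>The exponent Y is a potential: a passage near the pinched fibre raises it by the depth of
  the passage, each step below the line x = 1 lowers it by one and costs a factor
  \<alpha> = \<alpha> powr (1 + \<gamma>) * \<alpha> powr (- \<gamma>), and every other step contracts by \<alpha> powr (- \<gamma>).\<close>

lemma potential:
  assumes "1 \<le> n" "\<And>j. j \<in> {1..n} \<Longrightarrow> b / 2 * (1 / a) ^ Q \<le> dist \<theta> (orb j)"
  shows "\<exists>Y. (1 / a) ^ Y \<le> ub n \<theta> \<and>
    (ub (n - 1) \<theta> - ub n \<theta>) * \<alpha> powr ((1 + \<gamma>) * real Y) \<le>
      L * \<alpha> powr ((1 + \<gamma>) * real (\<Sum>j<n. depth Q (\<theta> - orb (Suc j))) - \<gamma> * (real n - 1))"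
  using assms
proof (induction n arbitrary: \<theta> rule: nat_induct_at_least)
  case base
  let ?p = "\<theta> - to_circle \<omega>"
  have aL: "1 \<le> a * L" using a_gt_1 L_ge_1 mult_mono[of 1 a 1 L] by simp
  have "b / 2 * (1 / a) ^ Q \<le> dist ?p 0"
    using base[of 1] by (simp add: dist_circle_diff_0)
  then have "(1 / a) ^ depth Q ?p \<le> min 1 (2 / b * dist ?p 0)" by (rule depth_bound)
  also have "min 1 (2 / b * dist ?p 0) \<le> f ?p L" using steep[of L ?p] L_pos aL by simp
  finally have "(1 / a) ^ depth Q ?p \<le> ub 1 \<theta>" by simp
  moreover have "(L - ub 1 \<theta>) * \<alpha> powr ((1 + \<gamma>) * real (depth Q ?p))
      \<le> L * \<alpha> powr ((1 + \<gamma>) * real (depth Q ?p))"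
    using ub_range[of 1 \<theta>] by (intro mult_right_mono) auto
  ultimately show ?case by (intro exI[of _ "depth Q ?p"]) simp
next
  case (Suc n)
  let ?p = "\<theta> - to_circle \<omega>"
  define S where "S = depth Q ?p"
  define D where "D = ub (n - 1) ?p - ub n ?p"
  define R where "R = real (\<Sum>j<n. depth Q (?p - orb (Suc j)))"
  have "b / 2 * (1 / a) ^ Q \<le> dist ?p (orb j)" if "j \<in> {1..n}" for j
  proof -
    have "dist ?p (orb j) = dist \<theta> (orb (Suc j))"
      using dist_circle_translate(1)[of ?p "to_circle \<omega>" "orb j"]
      unfolding orb_Suc by simp
    then show ?thesis using Suc.prems[of "Suc j"] that by simp
  qed
  from Suc.IH[OF this] obtain Y where Y: "(1 / a) ^ Y \<le> ub n ?p"
    "D * \<alpha> powr ((1 + \<gamma>) * real Y) \<le> L * \<alpha> powr ((1 + \<gamma>) * R - \<gamma> * (real n - 1))"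
    unfolding D_def R_def by blast
  have "b / 2 * (1 / a) ^ Q \<le> dist ?p 0"
    using Suc.prems[of 1] by (simp add: dist_circle_diff_0)
  then have S: "(1 / a) ^ S \<le> min 1 (2 / b * dist ?p 0)" unfolding S_def by (rule depth_bound)
  have sum: "real (\<Sum>j<Suc n. depth Q (\<theta> - orb (Suc j))) = S + R"
  proof -
    have shift: "\<theta> - orb (Suc (Suc j)) = ?p - orb (Suc j)" for j
      unfolding orb_Suc[of "Suc j"] by (simp add: algebra_simps)
    show ?thesis
      unfolding sum.lessThan_Suc_shift shift S_def R_def by simp
  qed
  have D: "0 \<le> D" unfolding D_def using ub_antimono[of "n - 1" n ?p] by simp
  have ub_Suc: "ub (Suc n) \<theta> = f ?p (ub n ?p)" "ub n \<theta> = f ?p (ub (n - 1) ?p)"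
    using Suc.hyps by (simp, cases n) auto
  have u: "0 \<le> ub n ?p" "ub n ?p \<le> L" "ub n ?p \<le> ub (n - 1) ?p" "ub (n - 1) ?p \<le> L"
    using ub_range ub_antimono[of "n - 1" n ?p] by auto
  have below: "min 1 (a * ub n ?p) * (1 / a) ^ S \<le> ub (Suc n) \<theta>"
  proof -
    have "min 1 (a * ub n ?p) * (1 / a) ^ S \<le> min 1 (a * ub n ?p) * min 1 (2 / b * dist ?p 0)"
      using S u a_gt_1 by (intro mult_left_mono) auto
    then show ?thesis using steep[of "ub n ?p" ?p] u unfolding ub_Suc by simp
  qed
  have pow: "x * \<alpha> powr (e1 + e2) \<le> L * \<alpha> powr (e3 + e2)"
    if "x \<le> D" "D * \<alpha> powr e1 \<le> L * \<alpha> powr e3" for x e1 e2 e3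
  proof -
    have "x * \<alpha> powr e1 * \<alpha> powr e2 \<le> D * \<alpha> powr e1 * \<alpha> powr e2"
      using that(1) by (intro mult_right_mono) auto
    also have "\<dots> \<le> L * \<alpha> powr e3 * \<alpha> powr e2" using that(2) by (intro mult_right_mono) auto
    finally show ?thesis by (simp add: powr_add mult.assoc)
  qed
  let ?E = "(1 + \<gamma>) * (real S + R) - \<gamma> * (real (Suc n) - 1)"
  have "\<exists>Y'. (1 / a) ^ Y' \<le> ub (Suc n) \<theta> \<and>
    (ub n \<theta> - ub (Suc n) \<theta>) * \<alpha> powr ((1 + \<gamma>) * real Y') \<le> L * \<alpha> powr ?E"
  proof (cases "1 \<le> ub n ?p")
    case True
    \<comment> \<open>Above the line \<open>x = 1\<close> the old exponent \<open>Y\<close> is given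
      up, which only weakens the bound on \<open>D\<close>; the new one is the depth
      \<open>S\<close> of this passage.\<close>
    have "1 \<le> a * ub n ?p" using a_gt_1 True mult_mono[of 1 a 1 "ub n ?p"] by simp
    then have "(1 / a) ^ S \<le> ub (Suc n) \<theta>" using below by simp
    moreover have "(ub n \<theta> - ub (Suc n) \<theta>) * \<alpha> powr ((1 + \<gamma>) * real S) \<le> L * \<alpha> powr ?E"
    proof -
      have "ub n \<theta> - ub (Suc n) \<theta> \<le> D * \<alpha> powr - \<gamma>"
        using fibre_contracts[OF True u(3,4), of ?p] by (simp add: ub_Suc D_def mult.commute)
      then have "(ub n \<theta> - ub (Suc n) \<theta>) * \<alpha> powr ((1 + \<gamma>) * real S)
          \<le> D * \<alpha> powr - \<gamma> * \<alpha> powr ((1 + \<gamma>) * real S)"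
        by (intro mult_right_mono) auto
      also have "\<dots> = D * \<alpha> powr (0 + ((1 + \<gamma>) * real S - \<gamma>))"
        by (simp add: powr_add[symmetric] mult.assoc)
      also have "\<dots> \<le> L * \<alpha> powr ((1 + \<gamma>) * R - \<gamma> * (real n - 1) + ((1 + \<gamma>) * real S - \<gamma>))"
      proof (rule pow[OF order_refl])
        have "D * \<alpha> powr 0 \<le> D * \<alpha> powr ((1 + \<gamma>) * real Y)"
          using D alpha gamma by (intro mult_left_mono powr_mono) auto
        then show "D * \<alpha> powr 0 \<le> L * \<alpha> powr ((1 + \<gamma>) * R - \<gamma> * (real n - 1))"
          using Y(2) by linarith
      qed
      also have "(1 + \<gamma>) * R - \<gamma> * (real n - 1) + ((1 + \<gamma>) * real S - \<gamma>) = ?E"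
        by (simp add: algebra_simps)
      finally show ?thesis .
    qed
    ultimately show ?thesis by blast
  next
    case False
    \<comment> \<open>Below the line \<open>x = 1\<close> the exponent is positive, and the slope
      \<open>a\<close> at 0 recovers one factor of \<open>1 / a\<close>: the new exponent is
      \<open>Y - 1 + S\<close>.\<close>
    then have "Y \<noteq> 0" using Y(1) by (intro notI) simp
    then obtain Z where Z: "Y = Suc Z" by (cases Y) auto
    have "(1 / a) ^ Z \<le> a * ub n ?p" using Y(1) a_gt_1 by (simp add: Z field_simps)
    moreover have "(1 / a) ^ Z \<le> 1" using a_gt_1 by (intro power_le_one) auto
    ultimately have "(1 / a) ^ Z * (1 / a) ^ S \<le> min 1 (a * ub n ?p) * (1 / a) ^ S"
      using a_gt_1 by (intro mult_right_mono) auto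
    then have "(1 / a) ^ (Z + S) \<le> ub (Suc n) \<theta>" using below by (simp add: power_add)
    moreover have "(ub n \<theta> - ub (Suc n) \<theta>) * \<alpha> powr ((1 + \<gamma>) * real (Z + S)) \<le> L * \<alpha> powr ?E"
    proof -
      have "ub n \<theta> - ub (Suc n) \<theta> \<le> D * \<alpha>"
        using fibre_lipschitz[OF u(1,3,4), of ?p] by (simp add: ub_Suc D_def mult.commute)
      then have "(ub n \<theta> - ub (Suc n) \<theta>) * \<alpha> powr ((1 + \<gamma>) * real (Z + S))
          \<le> D * \<alpha> powr 1 * \<alpha> powr ((1 + \<gamma>) * real (Z + S))"
        using alpha by (intro mult_right_mono) auto
      also have "\<dots> = D * \<alpha> powr (1 + (1 + \<gamma>) * real (Z + S))"
        unfolding powr_add by (simp only: mult.assoc)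
      also have "1 + (1 + \<gamma>) * real (Z + S) = (1 + \<gamma>) * real Y + ((1 + \<gamma>) * real S - \<gamma>)"
        by (simp add: Z algebra_simps)
      also have "D * \<alpha> powr \<dots> \<le> L * \<alpha> powr ((1 + \<gamma>) * R - \<gamma> * (real n - 1) + ((1 + \<gamma>) * real S - \<gamma>))"
        by (rule pow[OF order_refl Y(2)])
      also have "(1 + \<gamma>) * R - \<gamma> * (real n - 1) + ((1 + \<gamma>) * real S - \<gamma>) = ?E"
        by (simp add: algebra_simps)
      finally show ?thesis .
    qed
    ultimately show ?thesis by blast
  qed
  then show ?case unfolding sum by simp
qed

text \<open>A budget for the contraction \<gamma> k in the exponent: truncation depth costs a
  quarter of it, the visits at most half, and a quarter remains.\<close>

lemma ub_contraction:
  assumes "1 \<le> k" "\<And>j. j \<in> {1..k} \<Longrightarrow> (a powr - (\<gamma> / (8 * (1 + \<gamma>)))) ^ (2 * k) \<le> dist \<theta> (orb j)"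
  shows "ub (k - 1) \<theta> - ub k \<theta> \<le> L * \<alpha> powr (1 + 2 * \<gamma>) * (\<alpha> powr - (\<gamma> / 4)) ^ k"
proof -
  \<comment> \<open>Chosen so that truncation at about \<open>\<sigma> * k\<close> scales matches
    the radius of the exceptional balls and costs \<open>\<gamma> / 4 * k\<close>.\<close>
  define \<sigma> where "\<sigma> = \<gamma> / (4 * (1 + \<gamma>))"
  have \<sigma>: "0 < \<sigma>" "(1 + \<gamma>) * \<sigma> = \<gamma> / 4" using gamma by (auto simp: \<sigma>_def field_simps)
  define Q where "Q = nat \<lceil>\<sigma> * real k\<rceil>"
  have "0 \<le> \<sigma> * real k" using \<sigma> by simp
  then have Q: "\<sigma> * real k \<le> real Q" "real Q \<le> \<sigma> * real k + 1"
    unfolding Q_def by linarith+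
  have "b / 2 * (1 / a) ^ Q \<le> (a powr - (\<gamma> / (8 * (1 + \<gamma>)))) ^ (2 * k)"
  proof -
    have "b / 2 * (1 / a) ^ Q \<le> (1 / a) ^ Q" using b a_gt_1 by (intro mult_left_le_one_le) auto
    also have "\<dots> = a powr - real Q"
      using a_gt_1 by (simp add: powr_minus powr_realpow power_divide field_simps)
    also have "\<dots> \<le> a powr - (\<sigma> * real k)" using Q(1) a_gt_1 by (intro powr_mono) auto
    also have "- (\<sigma> * real k) = - (\<gamma> / (8 * (1 + \<gamma>))) * real (2 * k)"
      using gamma by (simp add: \<sigma>_def field_simps)
    also have "a powr \<dots> = (a powr - (\<gamma> / (8 * (1 + \<gamma>)))) ^ (2 * k)"
      unfolding powr_powr[symmetric] by (rule powr_realpow) (use a_gt_1 in simp)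
    finally show ?thesis .
  qed
  then have "b / 2 * (1 / a) ^ Q \<le> dist \<theta> (orb j)" if "j \<in> {1..k}" for j
    using assms(2)[OF that] by linarith
  from potential[OF assms(1) this] obtain Y where Y:
    "(ub (k - 1) \<theta> - ub k \<theta>) * \<alpha> powr ((1 + \<gamma>) * real Y) \<le>
      L * \<alpha> powr ((1 + \<gamma>) * real (\<Sum>j<k. depth Q (\<theta> - orb (Suc j))) - \<gamma> * (real k - 1))"
    by blast
  have "1 \<le> \<alpha> powr ((1 + \<gamma>) * real Y)" using alpha gamma by (intro ge_one_powr_ge_zero) auto
  then have "ub (k - 1) \<theta> - ub k \<theta> \<le> (ub (k - 1) \<theta> - ub k \<theta>) * \<alpha> powr ((1 + \<gamma>) * real Y)"
    using ub_antimono[of "k - 1" k \<theta>]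
      mult_left_mono[of 1 "\<alpha> powr ((1 + \<gamma>) * real Y)" "ub (k - 1) \<theta> - ub k \<theta>"]
    by simp
  also note Y
  \<comment> \<open>The constant \<open>1 + 2 * \<gamma>\<close> collects
    \<open>1 + \<gamma>\<close> from rounding \<open>Q\<close> up and \<gamma> from the exponent
    \<open>k - 1\<close>.\<close>
  also have "L * \<alpha> powr ((1 + \<gamma>) * real (\<Sum>j<k. depth Q (\<theta> - orb (Suc j))) - \<gamma> * (real k - 1))
      \<le> L * \<alpha> powr (1 + 2 * \<gamma> + - (\<gamma> / 4) * real k)"
  proof (intro mult_left_mono powr_mono)
    have "(1 + \<gamma>) * real (\<Sum>j<k. depth Q (\<theta> - orb (Suc j)))
        \<le> (1 + \<gamma>) * (\<sigma> * real k + 1 + 2 * real k / real m)"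
      using sum_depth_le[of Q \<theta> k] Q(2) gamma by (intro mult_left_mono) auto
    also have "\<dots> = (1 + \<gamma>) * \<sigma> * real k + (1 + \<gamma>) + (1 + \<gamma>) * 2 / real m * real k"
      by (simp add: algebra_simps)
    also have "(1 + \<gamma>) * 2 / real m * real k \<le> \<gamma> / 2 * real k"
    proof (rule mult_right_mono)
      \<comment> \<open>The lower bound on \<open>m\<close> enters here: it limits the cost of all
        visits to half of the contraction.\<close>
      have "4 * (1 + \<gamma>) \<le> \<gamma> * real m" using m gamma by (simp add: field_simps)
      then show "(1 + \<gamma>) * 2 / real m \<le> \<gamma> / 2" using m_pos by (simp add: field_simps)
    qed simp
    finally show "(1 + \<gamma>) * real (\<Sum>j<k. depth Q (\<theta> - orb (Suc j))) - \<gamma> * (real k - 1)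
        \<le> 1 + 2 * \<gamma> + - (\<gamma> / 4) * real k"
      unfolding \<sigma>(2) by (simp add: algebra_simps)
  qed (use alpha L_pos in auto)
  also have "\<dots> = L * \<alpha> powr (1 + 2 * \<gamma>) * (\<alpha> powr - (\<gamma> / 4)) ^ k"
  proof -
    have "(\<alpha> powr - (\<gamma> / 4)) powr real k = (\<alpha> powr - (\<gamma> / 4)) ^ k"
      by (rule powr_realpow) (use alpha in simp)
    then show ?thesis
      unfolding powr_add[of \<alpha> "1 + 2 * \<gamma>"] powr_powr[symmetric] by (simp only: mult.assoc)
  qed
  finally show ?thesis .
qed

lemma closure_graph_steep:
  "closure {(\<theta>, graph \<theta>) | \<theta>. True} = {(\<theta>, x). 0 \<le> x \<and> x \<le> graph \<theta>}"
proof -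
  define s where "s = a powr - (\<gamma> / (8 * (1 + \<gamma>)))"
  have s: "0 < s" "s < 1"
    using powr_less_mono[of "- (\<gamma> / (8 * (1 + \<gamma>)))" 0 a] a_gt_1 gamma by (auto simp: s_def)
  have "\<forall>\<^sub>F A in sequentially. \<alpha>\<^sup>2 * s ^ A \<le> 1"
    using s by (intro power_eventually_le) auto
  then have "\<forall>\<^sub>F A in sequentially. 1 \<le> A \<and> s ^ A * \<alpha>\<^sup>2 \<le> 1"
    using eventually_ge_at_top[of 1] by eventually_elim (simp add: mult.commute)
  then obtain A where A: "1 \<le> A" "s ^ A * \<alpha>\<^sup>2 \<le> 1"
    by (auto simp: eventually_sequentially)
  interpret contracting_pinched_skew \<omega> L \<alpha> \<beta> c d f s "L * \<alpha> powr (1 + 2 * \<gamma>)" "\<alpha> powr - (\<gamma> / 4)" A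
  proof unfold_locales
    show "\<alpha> powr - (\<gamma> / 4) < 1" using powr_less_mono[of "- (\<gamma> / 4)" 0 \<alpha>] alpha gamma by simp
    show "0 < \<alpha> powr - (\<gamma> / 4)" "0 \<le> L * \<alpha> powr (1 + 2 * \<gamma>)" using alpha L_pos by auto
  qed (use s A ub_contraction in \<open>auto simp: s_def\<close>)
  show ?thesis by (rule closure_graph)
qed

end

section \<open>Reduction of the hypotheses to the steep setting\<close>

theorem theorem4p1:
  fixes L \<omega> c d \<alpha> \<gamma> \<beta> a b :: real
    and m :: nat
    and f :: "circle \<Rightarrow> real \<Rightarrow> real"
    and T :: "circle \<times> real \<Rightarrow> circle \<times> real"
    and \<tau> :: "nat \<Rightarrow> circle"
    and \<phi> :: "circle \<Rightarrow> real"
  defines "T \<equiv> skew_product \<omega> f"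
    and "\<tau> \<equiv> (\<lambda>n. to_circle (real n * \<omega>))"
    and "\<phi> \<equiv> upper_bounding_graph L T"
  assumes "L > 0"
    and "\<omega> \<in> {0..1} - \<rat>"
    and "T ` (UNIV \<times> {0..L}) \<subseteq> UNIV \<times> {0..L}"
    and "continuous_on (UNIV \<times> {0..L}) T"
    and "\<And>\<theta>. mono_on {0..L} (f \<theta>)"
    and "\<And>\<theta>. f \<theta> 0 = 0"
    and "\<exists>\<theta>. \<forall>x\<in>{0..L}. f \<theta> x = 0"
    and "c > 0" and "d > 0"
    and "\<And>n. n \<ge> 1 \<Longrightarrow> dist (\<tau> n) 0 \<ge> c * real n powr (- d)"
    and "\<alpha> > 2" and "\<gamma> > 0"
    and "\<And>\<theta> x. x \<in> {0..L} \<Longrightarrow>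
           lower_deriv (f \<theta>) x {0..L} \<le> ereal \<alpha> \<and>
           upper_deriv (f \<theta>) x {0..L} \<le> ereal \<alpha>"
    and "\<And>\<theta> x. x \<in> {0..L} \<Longrightarrow> x \<ge> 1 \<Longrightarrow>
           lower_deriv (f \<theta>) x {0..L} \<le> ereal (\<alpha> powr (- \<gamma>)) \<and>
           upper_deriv (f \<theta>) x {0..L} \<le> ereal (\<alpha> powr (- \<gamma>))"
    and "\<beta> > 0"
    and "\<And>\<theta> x. x \<in> {0..L} \<Longrightarrow>
           \<bar>lower_deriv (\<lambda>t. f (\<theta> + to_circle t) x) 0 UNIV\<bar> \<le> ereal \<beta> \<and>
           \<bar>upper_deriv (\<lambda>t. f (\<theta> + to_circle t) x) 0 UNIV\<bar> \<le> ereal \<beta>"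
    and "real m > 4 + 4 / \<gamma>"
    and "a \<ge> (real m + 1) powr d"
    and "0 < b" and "b \<le> c"
    and "\<And>n. n \<in> {1..m - 1} \<Longrightarrow> dist (\<tau> n) 0 \<ge> b"
    and "\<And>\<theta> x. x \<in> {0..L} \<Longrightarrow>
           f \<theta> x \<ge> min 1 (a * x) * min 1 (2 / b * dist \<theta> 0)"
  shows "closure {(\<theta>, \<phi> \<theta>) | \<theta>. True} = {(\<theta>, x). x \<in> {0..L} \<and> 0 \<le> x \<and> x \<le> \<phi> \<theta>}"
proof -
  note hyps = assms(4-)
  have range: "f \<theta> x \<in> {0..L}" if "x \<in> {0..L}" for \<theta> x
    using hyps(3) that by (force simp: T_def skew_product_def image_subset_iff)
  have "0 < 4 / \<gamma>" using hyps(12) by simp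
  then have m: "4 < real m" using hyps(17) by linarith
  have "1 < (real m + 1) powr d" using m hyps(9) by (intro gr_one_powr) auto
  then have a: "1 < a" using hyps(18) by linarith
  have far: "b \<le> dist (to_circle (real 1 * \<omega>)) 0"
    using hyps(21)[of 1] m by (simp add: \<tau>_def)
  \<comment> \<open>Over \<open>orb 1\<close> the second factor of the steepness bound is 1, so the
    image of \<open>L\<close> is at least \<open>min 1 (a * L)\<close>; as \<open>a > 1\<close> and
    images stay below \<open>L\<close>, this forces \<open>L \<ge> 1\<close>.\<close>
  have "1 \<le> L"
  proof (rule ccontr)
    assume "\<not> ?thesis"
    moreover have "min 1 (2 / b * dist (to_circle (real 1 * \<omega>)) 0) = 1"
      using far hyps(19) by (simp add: min_def field_simps)
    then have "min 1 (a * L) \<le> L"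
      using hyps(22)[of L "to_circle (real 1 * \<omega>)"] range[of L "to_circle (real 1 * \<omega>)"] hyps(1) by simp
    moreover have "L < a * L" using a hyps(1) by simp
    ultimately show False by (simp add: min_def split: if_splits)
  qed
  obtain \<theta>0 where \<theta>0: "\<And>x. x \<in> {0..L} \<Longrightarrow> f \<theta>0 x = 0" using hyps(7) by blast
  \<comment> \<open>Over any other base point the steepness bound is positive at
    \<open>x = L\<close>, so the fibre map cannot vanish there.\<close>
  have "\<theta>0 = 0"
  proof (rule ccontr)
    assume "\<theta>0 \<noteq> 0"
    then have "0 < min 1 (a * L) * min 1 (2 / b * dist \<theta>0 0)"
      using a hyps(1,19) by simp
    then show False using hyps(22)[of L \<theta>0] \<theta>0[of L] hyps(1) by simp
  qed
  interpret steep_pinched_skew \<omega> L \<alpha> \<beta> c d f \<gamma> a b m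
  proof unfold_locales
    show "0 < L" "2 < \<alpha>" "0 < \<beta>" "0 < c" "0 < d" "0 < \<gamma>" "0 < b" "b \<le> c" "1 \<le> L"
      using hyps \<open>1 \<le> L\<close> by blast+
    show "\<omega> \<notin> \<rat>" using hyps(2) by blast
    show "4 + 4 / \<gamma> < real m" "(real m + 1) powr d \<le> a" using hyps(17,18) by blast+
    \<comment> \<open>Circle distances are at most 1/2, and \<open>b\<close> is bounded by one of
      them.\<close>
    show "b \<le> 1" using far dist_circle_le_half[of "to_circle (real 1 * \<omega>)" 0] by linarith
    show "f \<theta> x \<in> {0..L}" if "x \<in> {0..L}" for \<theta> x using range that by blast
    show "f \<theta> 0 = 0" for \<theta> by (rule hyps(6))
    show "f 0 x = 0" if "x \<in> {0..L}" for x using \<theta>0 that \<open>\<theta>0 = 0\<close> by blast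
    show "f \<theta> x \<le> f \<theta> y" if "0 \<le> x" "x \<le> y" "y \<le> L" for \<theta> x y
      using mono_onD[OF hyps(5), of x y \<theta>] that by simp
    show "f \<theta> y - f \<theta> x \<le> \<alpha> * (y - x)" if "0 \<le> x" "x \<le> y" "y \<le> L" for \<theta> x y
      by (rule le_if_upper_deriv_le[where S = "{0..L}"]) (use that hyps(13) in auto)
    show "f \<theta> y - f \<theta> x \<le> \<alpha> powr - \<gamma> * (y - x)" if "1 \<le> x" "x \<le> y" "y \<le> L" for \<theta> x y
      by (rule le_if_upper_deriv_le[where S = "{0..L}"]) (use that hyps(14) in auto)
    show "\<bar>f \<theta> x - f \<theta>' x\<bar> \<le> \<beta> * dist \<theta> \<theta>'" if x: "x \<in> {0..L}" for \<theta> \<theta>' x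
    proof (rule circle_lipschitz_if_derivs_le[where g = "\<lambda>\<theta>. f \<theta> x"])
      have abs_le: "z \<le> ereal \<beta> \<and> ereal (- \<beta>) \<le> z" if "\<bar>z\<bar> \<le> ereal \<beta>" for z
        using that by (cases z) auto
      fix \<psi>
      show "upper_deriv (\<lambda>t. f (\<psi> + to_circle t) x) 0 UNIV \<le> ereal \<beta>"
        "ereal (- \<beta>) \<le> lower_deriv (\<lambda>t. f (\<psi> + to_circle t) x) 0 UNIV"
        using abs_le hyps(16)[OF x, of \<psi>] by blast+
    qed
    show "c * real n powr - d \<le> dist (to_circle (real n * \<omega>)) 0" if "1 \<le> n" for n
      using hyps(10)[OF that] by (simp add: \<tau>_def)
    show "b \<le> dist (to_circle (real n * \<omega>)) 0" if "n \<in> {1..m - 1}" for n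
      using hyps(21)[OF that] by (simp add: \<tau>_def)
    show "min 1 (a * x) * min 1 (2 / b * dist \<theta> 0) \<le> f \<theta> x" if "x \<in> {0..L}" for \<theta> x
      using hyps(22)[OF that] by blast
  qed
  have "{(\<theta>, x). x \<in> {0..L} \<and> 0 \<le> x \<and> x \<le> graph \<theta>} = {(\<theta>, x). 0 \<le> x \<and> x \<le> graph \<theta>}"
  proof -
    have "x \<le> L" if "x \<le> graph \<theta>" for x \<theta> using graph_le_ub[of \<theta> 0] that by simp
    then show ?thesis by auto
  qed
  then show ?thesis
    unfolding \<phi>_def T_def upper_bounding_graph_eq using closure_graph_steep by simp
qed

end
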